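(* Let $n\ge2$ and let $\mathcal E_n$ be the set of real symmetric positive definite $n\times n$ matrices with all diagonal entries equal to $1$. For $\rho=(\rho_{ij})_{1\le i<j\le n}\in(-1,1)^{\binom n2}$ define, for $1\le r\le s\le n$, $$P_{\{r,\dots,s\}}=(-1)^{\lfloor (s-r+1)/2\rfloor}\prod_{r\le i<j\le s}(1-\rho_{ij}^2),\qquad P_\emptyset=1,$$ and for $i<j$, $A_{ij}=(-1)^{\lceil (j-i-1)/2\rceil}\rho_{ij}\sqrt{P_{\{i,\dots,j-1\}}P_{\{i+1,\dots,j\}}}$. Let $\Psi(\rho)=Y=(y_{ij})$ be the symmetric matrix with $y_{ii}=1$ and, for $i<j$, $y_{ij}=y_{ji}=\sum_C W_{\mathscr C}(C)\big|_{a\to A,\,p\to P}$, the sum over Catalan paths $C$ in $G_n$ from node $i$ to node $j$, where in each weight every $a_{kl|\{k+1,\dots,l-1\}}$ is replaced by $A_{kl}$ and every $p_{\{r,\dots,s\}}$ by $P_{\{r,\dots,s\}}$. Then $\Psi$ is a bijection from $(-1,1)^{\binom n2}$ onto $\mathcal E_n$, and its inverse sends $Y\in\mathcal E_n$ to its vector of connected partial correlations $\big(\rho_{ij|\{i+1,\dots,j-1\}}(Y)\big)_{i<j}$. In particular every correlation matrix $Y$ satisfies $Y=\Psi\big((\rho_{ij|\{i+1,\dots,j-1\}}(Y))_{i<j}\big)$, so its entries are expressed uniquely in terms of its $\binom n2$ connected partial correlations.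
   Context: Minors: $X^J_I$ is the determinant of the submatrix of $X$ with rows $I$ and columns $J$ (increasing order; empty minor $=1$). For a positive definite symmetric $Y$, $i<j$ and $I\subseteq[n]\setminus\{i,j\}$, the partial correlation is $\rho_{ij|I}(Y)=\dfrac{Y^{\{j\}\cup I}_{\{i\}\cup I}}{\sqrt{Y^{\{i\}\cup I}_{\{i\}\cup I}\,Y^{\{j\}\cup I}_{\{j\}\cup I}}}$ (equivalently $(-1)^{\lceil|I|/2\rceil}a_{ij|I}/\sqrt{p_{\{i\}\cup I}p_{\{j\}\cup I}}$ with $p_I=(-1)^{\lfloor|I|/2\rfloor}Y^I_I$, $a_{ij|I}=(-1)^{\lceil|I|/2\rceil}Y^{\{j\}\cup I}_{\{i\}\cup I}$); it is called connected if $I=\{i+1,\dots,j-1\}$. $G_n$ has vertices the lattice points $(x,y)$ with $0\le y\le x$, $x+y\le2n-2$, $x+y$ even, and edges the steps $(1,\pm1)$; node $k$ is $(2k-2,0)$. For a vertex $v=(x,y)$ with $y\ge1$ let $k=(x-y+2)/2$, $l=(x+y+2)/2$, $I(v)=\{k+1,\dots,l-1\}$, $A(v)=a_{kl|I(v)}$, $P(v)=p_{I(v)}$ (with $p_\emptyset=1$). A Catalan path from node $i$ to node $j$ ($i<j$) is a sequence $v_0=(2i-2,0),\dots,v_m=(2j-2,0)$ with steps $(1,\pm1)$ and all $y\ge0$; a local maximum (minimum) is an interior vertex both of whose neighbours are lower (higher). Its weight is the Laurent monomial $$W_{\mathscr C}(C)=\prod_{v\text{ loc. max}}\frac{A(v)}{P(v)}\cdot\frac{\prod_{v=(x,y)\text{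 loc. min},\,y\ge1}A(v)}{\prod_{(x,y)\text{ loc. min}}P((x,y+2))}.$$ *)

theory Defs
  imports Complex_Main "Jordan_Normal_Form.Determinant" "Jordan_Normal_Form.DL_Submatrix"
begin

section \<open>Correlation matrices and partial correlations\<close>

definition pos_def_mat :: "nat \<Rightarrow> real mat \<Rightarrow> bool" where
  "pos_def_mat n Y \<longleftrightarrow> (\<forall>v \<in> carrier_vec n. v \<noteq> 0\<^sub>v n \<longrightarrow> v \<bullet> (Y *\<^sub>v v) > 0)"

definition correlation_mats :: "nat \<Rightarrow> real mat set" where
  "correlation_mats n =
     {Y \<in> carrier_mat n n. transpose_mat Y = Y \<and> pos_def_mat n Y \<and> (\<forall>i<n. Y $$ (i, i) = 1)}"

text \<open>Rows and columns are numbered from 1 throughout, whereas matrices of type \<open>real mat\<close>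
  are indexed from 0; the index sets are shifted accordingly.  The rows come first, so
  \<open>minor X I J\<close> is \<open>X\<close> with lower index \<open>I\<close> and upper index \<open>J\<close>.\<close>

definition minor :: "real mat \<Rightarrow> nat set \<Rightarrow> nat set \<Rightarrow> real" where
  "minor X I J = det (submatrix X ((\<lambda>k. k - 1) ` I) ((\<lambda>k. k - 1) ` J))"

text \<open>The rows \<open>insert i I\<close> and the columns \<open>insert j I\<close> are both taken in increasing order, so
  this differs from the usual statistical partial correlation by a sign depending on \<open>i\<close>, \<open>j\<close>
  and \<open>I\<close>.\<close>

definition partial_corr :: "real mat \<Rightarrow> nat \<Rightarrow> nat \<Rightarrow> nat set \<Rightarrow> real" where
  "partial_corr Y i j I =
     minor Y (insert i I) (insert j I) /
       sqrt (minor Y (insert i I) (insert i I) * minor Y (insert j I) (insert j I))"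

definition index_pairs :: "nat \<Rightarrow> (nat \<times> nat) set" where
  "index_pairs n = {(i, j). 1 \<le> i \<and> i < j \<and> j \<le> n}"

definition rho_cube :: "nat \<Rightarrow> (nat \<times> nat \<Rightarrow> real) set" where
  "rho_cube n = index_pairs n \<rightarrow>\<^sub>E {-1<..<1}"

definition connected_partial_corrs :: "nat \<Rightarrow> real mat \<Rightarrow> (nat \<times> nat \<Rightarrow> real)" where
  "connected_partial_corrs n Y =
     (\<lambda>(i, j) \<in> index_pairs n. partial_corr Y i j {i+1..j-1})"


section \<open>Catalan paths and their weights\<close>

definition grid_vertices :: "nat \<Rightarrow> (nat \<times> nat) set" where
  "grid_vertices n = {(x, y). y \<le> x \<and> x + y \<le> 2 * n - 2 \<and> even (x + y)}"

definition grid_edge :: "nat \<times> nat \<Rightarrow> nat \<times> nat \<Rightarrow> bool" where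
  "grid_edge v w \<longleftrightarrow> fst w = fst v + 1 \<and> (snd w = snd v + 1 \<or> snd v = snd w + 1)"

definition node :: "nat \<Rightarrow> nat \<times> nat" where
  "node k = (2 * k - 2, 0)"

definition catalan_paths :: "nat \<Rightarrow> nat \<Rightarrow> nat \<Rightarrow> (nat \<times> nat) list set" where
  "catalan_paths n i j =
     {C. C \<noteq> [] \<and> hd C = node i \<and> last C = node j \<and> set C \<subseteq> grid_vertices n \<and>
         successively grid_edge C}"

text \<open>\<open>loc_maxs C\<close> and \<open>loc_mins C\<close> are sets of positions in \<open>C\<close>; as the first coordinate strictly
  increases along \<open>C\<close>, positions correspond bijectively to vertices.\<close>

definition loc_maxs :: "(nat \<times> nat) list \<Rightarrow> nat set" where
  "loc_maxs C = {t. 0 < t \<and> t + 1 < length C \<and>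
     snd (C ! (t - 1)) < snd (C ! t) \<and> snd (C ! (t + 1)) < snd (C ! t)}"

definition loc_mins :: "(nat \<times> nat) list \<Rightarrow> nat set" where
  "loc_mins C = {t. 0 < t \<and> t + 1 < length C \<and>
     snd (C ! (t - 1)) > snd (C ! t) \<and> snd (C ! (t + 1)) > snd (C ! t)}"

text \<open>On vertices of the grid both divisions are exact and the subtraction does not truncate.\<close>

definition lo :: "nat \<times> nat \<Rightarrow> nat" where
  "lo v = (fst v - snd v + 2) div 2"

definition hi :: "nat \<times> nat \<Rightarrow> nat" where
  "hi v = (fst v + snd v + 2) div 2"

text \<open>The weight is evaluated at given values of its variables: \<open>a k l\<close> is the value of the
  variable $a_{kl|\{k+1,\dots,l-1\}}$ and \<open>p S\<close> that of $p_S$.  The vertex above a local minimum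
  \<open>(x, y)\<close> is \<open>(x, y + 2)\<close>, again a vertex of the grid.\<close>

definition weight :: "(nat \<Rightarrow> nat \<Rightarrow> real) \<Rightarrow> (nat set \<Rightarrow> real) \<Rightarrow> (nat \<times> nat) list \<Rightarrow> real" where
  "weight a p C =
     (let A = (\<lambda>v. a (lo v) (hi v));
          P = (\<lambda>v. p {lo v + 1..hi v - 1})
      in (\<Prod>t \<in> loc_maxs C. A (C ! t) / P (C ! t)) *
         ((\<Prod>t \<in> {t \<in> loc_mins C. snd (C ! t) \<ge> 1}. A (C ! t)) /
          (\<Prod>t \<in> loc_mins C. P (fst (C ! t), snd (C ! t) + 2))))"


section \<open>The parametrization\<close>

text \<open>Only used for \<open>S = {r..s}\<close>, including \<open>S = {}\<close>.\<close>

definition P_of :: "(nat \<times> nat \<Rightarrow> real) \<Rightarrow> nat set \<Rightarrow> real" where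
  "P_of \<rho> S =
     (-1) ^ (card S div 2) * (\<Prod>(i, j) \<in> {(i, j). i \<in> S \<and> j \<in> S \<and> i < j}. 1 - (\<rho> (i, j))\<^sup>2)"

definition A_of :: "(nat \<times> nat \<Rightarrow> real) \<Rightarrow> nat \<Rightarrow> nat \<Rightarrow> real" where
  "A_of \<rho> i j =
     (-1) ^ nat \<lceil>real (j - i - 1) / 2\<rceil> * \<rho> (i, j) * sqrt (P_of \<rho> {i..j-1} * P_of \<rho> {i+1..j})"

definition Psi :: "nat \<Rightarrow> (nat \<times> nat \<Rightarrow> real) \<Rightarrow> real mat" where
  "Psi n \<rho> =
     (let y = (\<lambda>i j. \<Sum>C \<in> catalan_paths n i j. weight (A_of \<rho>) (P_of \<rho>) C)
      in mat n n (\<lambda>(i, j). if i = j then 1 else y (min i j + 1) (max i j + 1)))"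

text \<open>The sum over Catalan paths is a genuine finite sum.\<close>

lemma finite_catalan_paths: "finite (catalan_paths n i j)"
proof -
  have fin: "finite (grid_vertices n)"
    by (rule finite_subset[of _ "{..2 * n} \<times> {..2 * n}"]) (auto simp: grid_vertices_def)
  have "distinct C" if "successively grid_edge C" for C
  proof -
    have "successively (\<lambda>v w. fst v < fst w) C"
      using that by (rule successively_mono) (auto simp: grid_edge_def)
    then have "sorted_wrt (\<lambda>v w. fst v < fst w) C"
      by (subst (asm) successively_iff_sorted_wrt_strong) auto
    then show ?thesis
      by (induction C) auto
  qed
  then have "catalan_paths n i j \<subseteq> {C. set C \<subseteq> grid_vertices n \<and> length C \<le> card (grid_vertices n)}"
    using fin by (auto simp: catalan_paths_def) (metis card_mono distinct_card)
  then show ?thesis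
    using finite_lists_length_le[OF fin] finite_subset by blast
qed

end

theory Submission
  imports Defs
begin

text \<open>Read \<open>Y\<close> as the Gram matrix of vectors \<open>v\<^sub>1, \<dots>, v\<^sub>n\<close>.  For an interval \<open>{k..l}\<close> let \<open>f\<close> be
  the residual of \<open>v\<^sub>k\<close> after projection onto \<open>v\<^sub>k\<^sub>+\<^sub>1, \<dots>, v\<^sub>l\<close>, and let \<open>b\<close> be the residual of
  \<open>v\<^sub>l\<close> after projection onto \<open>v\<^sub>k, \<dots>, v\<^sub>l\<^sub>-\<^sub>1\<close>, scaled so that its inner product with \<open>v\<^sub>l\<close> is 1.
  The Levinson recursion
  \<open>f\<^sub>k\<^sub>,\<^sub>l\<^sub>-\<^sub>1 = f\<^sub>k\<^sub>,\<^sub>l + \<alpha> b\<^sub>k\<^sub>+\<^sub>1\<^sub>,\<^sub>l\<close> and \<open>b\<^sub>k\<^sub>,\<^sub>l = b\<^sub>k\<^sub>+\<^sub>1\<^sub>,\<^sub>l - \<beta> f\<^sub>k\<^sub>,\<^sub>l\<close> has coefficients that depend on the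
  connected partial correlations only, and \<open>\<alpha>\<close>, \<open>-\<beta>\<close> are exactly the weights of a local maximum
  and of a local minimum at the vertex of \<open>{k..l}\<close>.  So a step of a Catalan path up to that vertex
  carries \<open>f\<^sub>k\<^sub>,\<^sub>l\<^sub>-\<^sub>1\<close>, a step down to it carries \<open>b\<^sub>k\<^sub>,\<^sub>l\<close>, and the sum over the paths that continue to node \<open>j\<close>
  is the inner product with \<open>v\<^sub>j\<close>.  Conversely, any parameters in the open cube determine the
  entries of \<open>Y\<close> one diagonal after the other, and the residuals are orthogonal with positive norms,
  whence \<open>Y\<close> is positive definite.\<close>

section \<open>Products over the pairs in an interval\<close>

text \<open>For compatible \<open>Y\<close> this is the principal minor on \<open>m\<close>
  consecutive indices (\<open>interval_minor_iprod\<close>), \<open>m = 0\<close> being the empty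
  interval.\<close>

definition iprod :: "(nat \<times> nat \<Rightarrow> real) \<Rightarrow> nat \<Rightarrow> nat \<Rightarrow> real" where
  "iprod \<rho> k m = (\<Prod>(i, j) \<in> {(i, j). k \<le> i \<and> i < j \<and> j < k + m}. 1 - (\<rho> (i, j))\<^sup>2)"

lemma finite_interval_pairs: "finite {(i, j). k \<le> i \<and> i < j \<and> j < k + (m::nat)}"
  by (rule finite_subset[of _ "{..k + m} \<times> {..k + m}"]) auto

lemma iprod_0 [simp]: "iprod \<rho> k 0 = 1"
proof -
  have "{(i, j). k \<le> i \<and> i < j \<and> j < k + 0} = {}" by auto
  then show ?thesis unfolding iprod_def by (simp only: prod.empty)
qed

lemma iprod_1 [simp]: "iprod \<rho> k (Suc 0) = 1"
proof -
  have "{(i, j). k \<le> i \<and> i < j \<and> j < k + Suc 0} = {}" by auto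
  then show ?thesis unfolding iprod_def by (simp only: prod.empty)
qed

text \<open>Inclusion-exclusion: a pair avoids the last index, avoids the first, or joins the two
  ends; pairs avoiding both ends count twice. This mirrors the Desnanot-Jacobi identity for the
  interval minors.\<close>

lemma iprod_rec:
  "iprod \<rho> k (Suc (Suc m)) * iprod \<rho> (Suc k) m
    = iprod \<rho> k (Suc m) * iprod \<rho> (Suc k) (Suc m) * (1 - (\<rho> (k, Suc (k + m)))\<^sup>2)"
proof -
  define E where "E = (\<lambda>k m. {(i, j). k \<le> i \<and> i < j \<and> j < k + (m::nat)})"
  define g where "g = (\<lambda>(i, j). 1 - (\<rho> (i, j))\<^sup>2)"
  have fin: "finite (E k m)" for k m
    unfolding E_def by (rule finite_interval_pairs)
  have "E k (Suc (Suc m)) = insert (k, Suc (k + m)) (E k (Suc m) \<union> E (Suc k) (Suc m))"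
    by (auto simp: E_def)
  moreover have "(k, Suc (k + m)) \<notin> E k (Suc m) \<union> E (Suc k) (Suc m)"
    by (auto simp: E_def)
  ultimately have 1: "prod g (E k (Suc (Suc m)))
      = g (k, Suc (k + m)) * prod g (E k (Suc m) \<union> E (Suc k) (Suc m))"
    using fin by simp
  have 2: "E k (Suc m) \<inter> E (Suc k) (Suc m) = E (Suc k) m"
    by (auto simp: E_def)
  have "prod g (E k (Suc m) \<union> E (Suc k) (Suc m)) * prod g (E (Suc k) m)
      = prod g (E k (Suc m)) * prod g (E (Suc k) (Suc m))"
    using prod.union_inter[OF fin fin] 2 by metis
  then show ?thesis
    using 1 by (simp add: iprod_def g_def E_def)
qed

lemma iprod_pos:
  assumes "\<And>i j. k \<le> i \<Longrightarrow> i < j \<Longrightarrow> j < k + m \<Longrightarrow> \<rho> (i, j) \<in> {-1<..<1}"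
  shows "iprod \<rho> k m > 0"
  unfolding iprod_def
proof (rule prod_pos, clarsimp)
  fix i j assume "k \<le> i" "i < j" "j < k + m"
  from assms[OF this] show "(\<rho> (i, j))\<^sup>2 < 1"
    by (auto simp: abs_square_less_1)
qed

lemma P_of_interval: "P_of \<rho> {k..<k + m} = (-1) ^ (m div 2) * iprod \<rho> k m"
proof -
  have "{(i, j). i \<in> {k..<k + m} \<and> j \<in> {k..<k + m} \<and> i < j}
      = {(i, j). k \<le> i \<and> i < j \<and> j < k + m}" by auto
  then show ?thesis by (simp add: P_of_def iprod_def)
qed


section \<open>Forward and backward residuals\<close>

text \<open>Intervals \<open>{k..k + m}\<close> are encoded by \<open>k\<close> and \<open>m\<close>; \<open>iprod \<rho> k m\<close>, however, belongs to the
  interval \<open>{k..<k + m}\<close> of \<open>m\<close> elements.  \<open>reflection \<rho> k m\<close> and \<open>co_reflection \<rho> k m\<close> are the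
  coefficients \<open>\<alpha>\<close> and \<open>\<beta>\<close> of \<open>{k..k + m + 1}\<close>; \<open>fwd\<close> and \<open>bwd\<close> give the coefficients of \<open>f\<close> and
  \<open>b\<close> with respect to the vectors \<open>v\<^sub>i\<close>.\<close>

definition reflection :: "(nat \<times> nat \<Rightarrow> real) \<Rightarrow> nat \<Rightarrow> nat \<Rightarrow> real" where
  "reflection \<rho> k m = (-1) ^ m * \<rho> (k, Suc (k + m)) * sqrt (iprod \<rho> k (Suc m) * iprod \<rho> (Suc k) (Suc m))
     / iprod \<rho> (Suc k) m"

definition co_reflection :: "(nat \<times> nat \<Rightarrow> real) \<Rightarrow> nat \<Rightarrow> nat \<Rightarrow> real" where
  "co_reflection \<rho> k m = reflection \<rho> k m * iprod \<rho> (Suc k) m / iprod \<rho> k (Suc (Suc m))"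

fun fwd bwd :: "(nat \<times> nat \<Rightarrow> real) \<Rightarrow> nat \<Rightarrow> nat \<Rightarrow> nat \<Rightarrow> real" where
  "fwd \<rho> k 0 i = (if i = k then 1 else 0)"
| "fwd \<rho> k (Suc m) i = fwd \<rho> k m i - reflection \<rho> k m * bwd \<rho> (Suc k) m i"
| "bwd \<rho> k 0 i = (if i = k then 1 else 0)"
| "bwd \<rho> k (Suc m) i = bwd \<rho> (Suc k) m i - co_reflection \<rho> k m * fwd \<rho> k (Suc m) i"

lemma fwd_bwd_support:
  "i \<notin> {k..k + m} \<Longrightarrow> fwd \<rho> k m i = 0"
  "i \<notin> {k..k + m} \<Longrightarrow> bwd \<rho> k m i = 0"
proof (induction m arbitrary: k)
  case (Suc m)
  { case 1 then show ?case using Suc.IH[of k] Suc.IH[of "Suc k"] by auto }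
  { case 2 then show ?case using Suc.IH[of k] Suc.IH[of "Suc k"] by auto }
qed auto

lemma fwd_first [simp]: "fwd \<rho> k m k = 1"
  by (induction m) (auto simp: fwd_bwd_support)

text \<open>The drop in the squared norm of the forward residual when one more vector enters the
  projection. Squaring removes sign and root, and \<open>iprod_rec\<close> eliminates the
  parameter.\<close>

lemma reflection_square:
  assumes "iprod \<rho> k (Suc m) > 0" "iprod \<rho> (Suc k) (Suc m) > 0" "iprod \<rho> (Suc k) m > 0"
  shows "(reflection \<rho> k m)\<^sup>2 * iprod \<rho> (Suc k) m / iprod \<rho> (Suc k) (Suc m)
    = iprod \<rho> k (Suc m) / iprod \<rho> (Suc k) m - iprod \<rho> k (Suc (Suc m)) / iprod \<rho> (Suc k) (Suc m)"
proof -
  have "(reflection \<rho> k m)\<^sup>2 = (\<rho> (k, Suc (k + m)))\<^sup>2 * (iprod \<rho> k (Suc m) * iprod \<rho> (Suc k) (Suc m))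
      / (iprod \<rho> (Suc k) m)\<^sup>2"
    using assms by (simp add: reflection_def power_mult_distrib power_divide flip: power_mult)
  moreover have "iprod \<rho> k (Suc (Suc m))
      = iprod \<rho> k (Suc m) * iprod \<rho> (Suc k) (Suc m) * (1 - (\<rho> (k, Suc (k + m)))\<^sup>2) / iprod \<rho> (Suc k) m"
    using iprod_rec[of \<rho> k m] assms by (simp add: field_simps)
  ultimately show ?thesis
    using assms by (simp add: field_simps power2_eq_square)
qed

text \<open>As \<open>b\<close> is a residual divided by its squared norm, its last coefficient is
  the reciprocal of that norm. The value follows from the recursion alone, before any matrix
  \<open>Y\<close> enters.\<close>

lemma bwd_last:
  assumes "\<And>i j. k \<le> i \<Longrightarrow> i < j \<Longrightarrow> j \<le> k + m \<Longrightarrow> \<rho> (i, j) \<in> {-1<..<1}"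
  shows "bwd \<rho> k m (k + m) = iprod \<rho> k m / iprod \<rho> k (Suc m)"
  using assms
proof (induction m arbitrary: k)
  case (Suc m)
  have pos: "iprod \<rho> k (Suc m) > 0" "iprod \<rho> (Suc k) (Suc m) > 0" "iprod \<rho> (Suc k) m > 0"
    "iprod \<rho> k (Suc (Suc m)) > 0"
    using Suc.prems by (auto intro!: iprod_pos)
  have IH: "bwd \<rho> (Suc k) m (Suc (k + m)) = iprod \<rho> (Suc k) m / iprod \<rho> (Suc k) (Suc m)"
    using Suc.IH[of "Suc k"] Suc.prems by simp
  have f: "fwd \<rho> k m (Suc (k + m)) = 0"
    by (simp add: fwd_bwd_support)
  have "bwd \<rho> k (Suc m) (k + Suc m)
      = iprod \<rho> (Suc k) m / iprod \<rho> (Suc k) (Suc m)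
        * (1 + (reflection \<rho> k m)\<^sup>2 * iprod \<rho> (Suc k) m / iprod \<rho> k (Suc (Suc m)))"
    using IH f by (simp add: co_reflection_def algebra_simps power2_eq_square)
  also have "(reflection \<rho> k m)\<^sup>2 * iprod \<rho> (Suc k) m
      = (iprod \<rho> k (Suc m) / iprod \<rho> (Suc k) m
        - iprod \<rho> k (Suc (Suc m)) / iprod \<rho> (Suc k) (Suc m)) * iprod \<rho> (Suc k) (Suc m)"
    using reflection_square[OF pos(1-3)] pos by (simp add: nonzero_divide_eq_eq)
  also have "iprod \<rho> (Suc k) m / iprod \<rho> (Suc k) (Suc m) * (1 + \<dots> / iprod \<rho> k (Suc (Suc m)))
      = iprod \<rho> k (Suc m) / iprod \<rho> k (Suc (Suc m))"
    using pos by (simp add: field_simps)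
  finally show ?case .
qed simp

section \<open>Inner products with the residuals, and orthogonality\<close>

declare fwd.simps [simp del] bwd.simps [simp del]

text \<open>With \<open>Y\<close> read as a Gram matrix, the inner product of the combination with
  coefficients \<open>u\<close> and the vector \<open>v\<^sub>j\<close>.\<close>

definition pairing :: "nat \<Rightarrow> real mat \<Rightarrow> (nat \<Rightarrow> real) \<Rightarrow> nat \<Rightarrow> real" where
  "pairing n Y u j = (\<Sum>i=1..n. u i * Y $$ (i - 1, j - 1))"

definition unit_symmetric :: "nat \<Rightarrow> real mat \<Rightarrow> bool" where
  "unit_symmetric n Y \<longleftrightarrow>
     (\<forall>i\<in>{1..n}. \<forall>j\<in>{1..n}. Y $$ (i - 1, j - 1) = Y $$ (j - 1, i - 1)) \<and>
     (\<forall>i\<in>{1..n}. Y $$ (i - 1, i - 1) = 1)"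

lemma pairing_diff:
  "pairing n Y (\<lambda>i. u i - c * v i) j = pairing n Y u j - c * pairing n Y v j"
  by (simp add: pairing_def algebra_simps sum_subtractf sum_distrib_left)

lemma pairing_fwd_Suc:
  "pairing n Y (fwd \<rho> k (Suc m)) j
     = pairing n Y (fwd \<rho> k m) j - reflection \<rho> k m * pairing n Y (bwd \<rho> (Suc k) m) j"
  unfolding pairing_diff[symmetric] by (simp add: pairing_def fwd.simps)

lemma pairing_bwd_Suc:
  "pairing n Y (bwd \<rho> k (Suc m)) j
     = pairing n Y (bwd \<rho> (Suc k) m) j - co_reflection \<rho> k m * pairing n Y (fwd \<rho> k (Suc m)) j"
  unfolding pairing_diff[symmetric] by (simp add: pairing_def bwd.simps)

lemma sum_indicator_mult:
  "finite S \<Longrightarrow> (\<Sum>i\<in>S. (if i = k then 1 else 0) * f i) = (if k \<in> S then f k else (0::real))"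
  by (subst sum.cong[OF refl, of _ _ "\<lambda>i. if i = k then f i else 0"]) (auto simp: sum.delta)

lemma pairing_unit:
  assumes "k \<in> {1..n}"
  shows "pairing n Y (fwd \<rho> k 0) j = Y $$ (k - 1, j - 1)"
    and "pairing n Y (bwd \<rho> k 0) j = Y $$ (k - 1, j - 1)"
  using assms by (simp_all add: pairing_def sum_indicator_mult fwd.simps bwd.simps)

lemma pairing_commute:
  assumes "unit_symmetric n Y"
  shows "(\<Sum>j=1..n. v j * pairing n Y u j) = (\<Sum>j=1..n. u j * pairing n Y v j)"
proof -
  have "(\<Sum>j=1..n. v j * pairing n Y u j) = (\<Sum>j=1..n. \<Sum>i=1..n. v j * (u i * Y $$ (i - 1, j - 1)))"
    by (simp add: pairing_def sum_distrib_left)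
  also have "\<dots> = (\<Sum>i=1..n. \<Sum>j=1..n. v j * (u i * Y $$ (i - 1, j - 1)))"
    by (rule sum.swap)
  also have "\<dots> = (\<Sum>i=1..n. \<Sum>j=1..n. u i * (v j * Y $$ (j - 1, i - 1)))"
    using assms by (intro sum.cong refl) (auto simp: unit_symmetric_def)
  also have "\<dots> = (\<Sum>j=1..n. u j * pairing n Y v j)"
    by (simp add: pairing_def sum_distrib_left)
  finally show ?thesis .
qed

lemma sum_eq_single:
  assumes "finite S" "k \<in> S" "\<And>i. i \<in> S \<Longrightarrow> i \<noteq> k \<Longrightarrow> f i = 0"
  shows "sum f S = f k"
  using assms by (subst sum.remove[of S k]) (auto intro!: sum.neutral)

text \<open>The value at \<open>k\<close> is the squared norm of the residual, since
  \<open>v\<^sub>k\<close> has coefficient 1 in it and the other vectors of the interval are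
  orthogonal to it.\<close>

definition fwd_orth :: "nat \<Rightarrow> (nat \<times> nat \<Rightarrow> real) \<Rightarrow> real mat \<Rightarrow> nat \<Rightarrow> nat \<Rightarrow> bool" where
  "fwd_orth n \<rho> Y k m \<longleftrightarrow> (\<forall>j. k < j \<and> j \<le> k + m \<longrightarrow> pairing n Y (fwd \<rho> k m) j = 0) \<and>
     pairing n Y (fwd \<rho> k m) k = iprod \<rho> k (Suc m) / iprod \<rho> (Suc k) m"

definition bwd_orth :: "nat \<Rightarrow> (nat \<times> nat \<Rightarrow> real) \<Rightarrow> real mat \<Rightarrow> nat \<Rightarrow> nat \<Rightarrow> bool" where
  "bwd_orth n \<rho> Y k m \<longleftrightarrow> (\<forall>j. k \<le> j \<and> j < k + m \<longrightarrow> pairing n Y (bwd \<rho> k m) j = 0) \<and>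
     pairing n Y (bwd \<rho> k m) (k + m) = 1"

definition cube_on :: "(nat \<times> nat \<Rightarrow> real) \<Rightarrow> nat \<Rightarrow> nat \<Rightarrow> bool" where
  "cube_on \<rho> k m \<longleftrightarrow> (\<forall>i j. k \<le> i \<and> i < j \<and> j \<le> k + m \<longrightarrow> \<rho> (i, j) \<in> {-1<..<1})"

text \<open>A linear form of the condition that \<open>\<rho>\<close> lists the connected partial
  correlations of \<open>Y\<close> inside \<open>{k..k + m}\<close>; see
  \<open>partial_corr_connected\<close>. The inequality is strict because column
  \<open>i + d + 1\<close> is involved.\<close>

definition compat_on :: "nat \<Rightarrow> (nat \<times> nat \<Rightarrow> real) \<Rightarrow> real mat \<Rightarrow> nat \<Rightarrow> nat \<Rightarrow> bool" where
  "compat_on n \<rho> Y k m \<longleftrightarrow>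
     (\<forall>i d. k \<le> i \<and> i + d < k + m \<longrightarrow> pairing n Y (fwd \<rho> i d) (Suc (i + d)) = reflection \<rho> i d)"

lemma cube_on_iprod_pos: "cube_on \<rho> k m \<Longrightarrow> k \<le> i \<Longrightarrow> i + d \<le> Suc (k + m) \<Longrightarrow> iprod \<rho> i d > 0"
  by (rule iprod_pos) (auto simp: cube_on_def)

text \<open>The inner product of \<open>f\<close> and \<open>b\<close> is evaluated twice:
  \<open>f\<close> is orthogonal to every vector in \<open>b\<close> but the last, and
  \<open>b\<close> to every vector in \<open>f\<close> but the first.\<close>

lemma fwd_bwd_cross:
  assumes sym: "unit_symmetric n Y" and k: "1 \<le> k" "Suc (k + m) \<le> n"
    and f: "fwd_orth n \<rho> Y k m" and b: "bwd_orth n \<rho> Y (Suc k) m"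
    and c: "pairing n Y (fwd \<rho> k m) (Suc (k + m)) = reflection \<rho> k m"
    and cube: "cube_on \<rho> (Suc k) m"
  shows "pairing n Y (bwd \<rho> (Suc k) m) k
    = reflection \<rho> k m * iprod \<rho> (Suc k) m / iprod \<rho> (Suc k) (Suc m)"
proof -
  let ?f = "fwd \<rho> k m" and ?b = "bwd \<rho> (Suc k) m"
  have last: "?b (Suc (k + m)) = iprod \<rho> (Suc k) m / iprod \<rho> (Suc k) (Suc m)"
    using bwd_last[of "Suc k" m \<rho>] cube by (auto simp: cube_on_def)
  have "(\<Sum>j=1..n. ?b j * pairing n Y ?f j) = ?b (Suc (k + m)) * pairing n Y ?f (Suc (k + m))"
  proof (rule sum_eq_single)
    fix i assume "i \<in> {1..n}" "i \<noteq> Suc (k + m)"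
    then show "?b i * pairing n Y ?f i = 0"
      using fwd_bwd_support(2)[of i "Suc k" m \<rho>] f
      by (cases "i \<in> {Suc k..Suc k + m}") (auto simp: fwd_orth_def)
  qed (use k in auto)
  moreover have "(\<Sum>j=1..n. ?f j * pairing n Y ?b j) = ?f k * pairing n Y ?b k"
  proof (rule sum_eq_single)
    fix i assume "i \<in> {1..n}" "i \<noteq> k"
    then show "?f i * pairing n Y ?b i = 0"
      using fwd_bwd_support(1)[of i k m \<rho>] b
      by (cases "i \<in> {k..k + m}") (auto simp: bwd_orth_def)
  qed (use k in auto)
  ultimately show ?thesis
    using pairing_commute[OF sym, of ?b ?f] last c by (simp add: mult.commute)
qed

text \<open>Subtracting a multiple of \<open>b\<close> keeps the inner orthogonality. As
  \<open>b\<close> pairs to 1 with the last vector, \<open>c\<close> says that this multiple cancels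
  the last column. The new norm comes from \<open>reflection_square\<close>.\<close>

lemma fwd_orth_Suc:
  assumes sym: "unit_symmetric n Y" and k: "1 \<le> k" "Suc (k + m) \<le> n"
    and f: "fwd_orth n \<rho> Y k m" and b: "bwd_orth n \<rho> Y (Suc k) m"
    and c: "pairing n Y (fwd \<rho> k m) (Suc (k + m)) = reflection \<rho> k m"
    and cube: "cube_on \<rho> k m" "cube_on \<rho> (Suc k) m"
  shows "fwd_orth n \<rho> Y k (Suc m)"
proof -
  have pos: "iprod \<rho> k (Suc m) > 0" "iprod \<rho> (Suc k) (Suc m) > 0" "iprod \<rho> (Suc k) m > 0"
    using cube_on_iprod_pos[OF cube(1), of k "Suc m"] cube_on_iprod_pos[OF cube(2)] by auto
  have "pairing n Y (fwd \<rho> k (Suc m)) j = 0" if "k < j" "j \<le> k + Suc m" for j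
    using that f b c by (cases "j = Suc (k + m)") (auto simp: pairing_fwd_Suc fwd_orth_def bwd_orth_def)
  moreover have "pairing n Y (fwd \<rho> k (Suc m)) k = iprod \<rho> k (Suc (Suc m)) / iprod \<rho> (Suc k) (Suc m)"
    using reflection_square[OF pos] f fwd_bwd_cross[OF sym k f b c cube(2)]
    by (simp add: pairing_fwd_Suc fwd_orth_def power2_eq_square)
  ultimately show ?thesis
    by (simp add: fwd_orth_def)
qed

text \<open>The new \<open>f\<close> pairs to zero with every vector of the interval but
  \<open>v\<^sub>k\<close>, so only that value changes, and \<open>co_reflection\<close> is the
  quotient that makes it vanish.\<close>

lemma bwd_orth_Suc:
  assumes sym: "unit_symmetric n Y" and k: "1 \<le> k" "Suc (k + m) \<le> n"
    and f: "fwd_orth n \<rho> Y k m" and b: "bwd_orth n \<rho> Y (Suc k) m"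
    and c: "pairing n Y (fwd \<rho> k m) (Suc (k + m)) = reflection \<rho> k m"
    and cube: "cube_on \<rho> k (Suc m)"
  shows "bwd_orth n \<rho> Y k (Suc m)"
proof -
  have cube': "cube_on \<rho> k m" "cube_on \<rho> (Suc k) m"
    using cube by (auto simp: cube_on_def)
  have pos: "iprod \<rho> k (Suc (Suc m)) > 0" "iprod \<rho> (Suc k) (Suc m) > 0"
    using cube_on_iprod_pos[OF cube] by auto
  note f' = fwd_orth_Suc[OF sym k f b c cube']
  have "pairing n Y (bwd \<rho> k (Suc m)) j = 0" if "k \<le> j" "j < k + Suc m" for j
  proof (cases "j = k")
    case True
    then show ?thesis
      using f' fwd_bwd_cross[OF sym k f b c cube'(2)] pos
      by (simp add: pairing_bwd_Suc fwd_orth_def co_reflection_def)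
  next
    case False
    then show ?thesis
      using that f' b by (auto simp: pairing_bwd_Suc fwd_orth_def bwd_orth_def)
  qed
  moreover have "pairing n Y (bwd \<rho> k (Suc m)) (k + Suc m) = 1"
    using f' b by (auto simp: pairing_bwd_Suc fwd_orth_def bwd_orth_def)
  ultimately show ?thesis
    by (simp add: bwd_orth_def)
qed

lemma compat_imp_orth:
  assumes "unit_symmetric n Y" "1 \<le> k" "k + m \<le> n" "cube_on \<rho> k m" "compat_on n \<rho> Y k m"
  shows "fwd_orth n \<rho> Y k m \<and> bwd_orth n \<rho> Y k m"
  using assms(2-)
proof (induction m arbitrary: k)
  case 0
  then show ?case
    using assms(1) by (auto simp: fwd_orth_def bwd_orth_def pairing_unit unit_symmetric_def)
next
  case (Suc m)
  have cube: "cube_on \<rho> k m" "cube_on \<rho> (Suc k) m"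
    using Suc.prems(3) by (auto simp: cube_on_def)
  have "compat_on n \<rho> Y k m" "compat_on n \<rho> Y (Suc k) m"
    using Suc.prems(4) by (auto simp: compat_on_def)
  with cube Suc.prems have *: "fwd_orth n \<rho> Y k m" "bwd_orth n \<rho> Y (Suc k) m"
    using Suc.IH[of k] Suc.IH[of "Suc k"] by auto
  have c: "pairing n Y (fwd \<rho> k m) (Suc (k + m)) = reflection \<rho> k m"
    using Suc.prems(4) by (auto simp: compat_on_def)
  have k: "1 \<le> k" "Suc (k + m) \<le> n"
    using Suc.prems by auto
  show ?case
    using fwd_orth_Suc[OF assms(1) k * c cube] bwd_orth_Suc[OF assms(1) k * c Suc.prems(3)] by blast
qed


section \<open>Connected minors\<close>

definition interval_minor :: "real mat \<Rightarrow> nat \<Rightarrow> nat \<Rightarrow> nat \<Rightarrow> real" where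
  "interval_minor Y r c m = det (mat m m (\<lambda>(a, b). Y $$ (r + a - 1, c + b - 1)))"

lemma pick_interval: "i < m \<Longrightarrow> pick {a..<a + m} i = a + i"
proof (induction i)
  case 0
  then show ?case by (auto intro!: Least_equality)
next
  case (Suc i)
  then have "pick {a..<a + m} (Suc i) = (LEAST b. b \<in> {a..<a + m} \<and> b > a + i)"
    by simp
  also have "\<dots> = a + Suc i"
    using Suc.prems by (intro Least_equality) auto
  finally show ?case .
qed

lemma minor_interval:
  assumes "Y \<in> carrier_mat n n" "1 \<le> r" "1 \<le> c" "r + m \<le> Suc n" "c + m \<le> Suc n"
  shows "minor Y {r..<r + m} {c..<c + m} = interval_minor Y r c m"
proof -
  define R where "R = (\<lambda>s. {s - 1..<s - 1 + m})"
  have shift: "(\<lambda>k. k - 1) ` {s..<s + m} = R s" if "1 \<le> s" for s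
    unfolding R_def
  proof (intro equalityI subsetI)
    fix x assume "x \<in> {s - 1..<s - 1 + m}"
    with that show "x \<in> (\<lambda>k. k - 1) ` {s..<s + m}"
      by (intro image_eqI[of _ _ "Suc x"]) auto
  qed (use that in auto)
  have card: "card {i. i < n \<and> i \<in> R s} = m" if "1 \<le> s" "s + m \<le> Suc n" for s
  proof -
    have "{i. i < n \<and> i \<in> R s} = R s"
      using that by (auto simp: R_def)
    then show ?thesis by (simp add: R_def)
  qed
  have pick: "pick (R s) i = s + i - 1" if "1 \<le> s" "i < m" for s i
    unfolding R_def pick_interval[OF that(2)] using that by simp
  have "submatrix Y (R r) (R c) = mat m m (\<lambda>(a, b). Y $$ (r + a - 1, c + b - 1))"
    unfolding submatrix_def using assms card[of r] card[of c]
    by (intro eq_matI) (auto simp: pick)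
  then show ?thesis
    unfolding minor_def interval_minor_def using shift assms by simp
qed

lemma sum_interval_shift:
  assumes "\<And>i. i \<notin> {r..r + m} \<Longrightarrow> f i = (0::real)" "1 \<le> r" "r + m \<le> n"
  shows "(\<Sum>i=1..n. f i) = (\<Sum>a<Suc m. f (r + a))"
proof -
  have "(\<Sum>i=1..n. f i) = (\<Sum>i\<in>{r..r + m}. f i)"
    using assms by (intro sum.mono_neutral_right) auto
  also have "\<dots> = (\<Sum>a<Suc m. f (r + a))"
    by (rule sum.reindex_bij_witness[of _ "\<lambda>a. r + a" "\<lambda>i. i - r"]) auto
  finally show ?thesis .
qed

text \<open>The first row is replaced by the combination of the rows with coefficients \<open>u\<close>, and the
  determinant is expanded along it.\<close>

lemma interval_minor_expand:
  assumes u: "\<And>i. i \<notin> {r..r + m} \<Longrightarrow> u i = 0" "u r = 1" and r: "1 \<le> r" "r + m \<le> n"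
    and b0: "b0 \<le> m" and zero: "\<And>b. b \<le> m \<Longrightarrow> b \<noteq> b0 \<Longrightarrow> pairing n Y u (c + b) = 0"
  shows "interval_minor Y r c (Suc m) = (-1) ^ b0 * pairing n Y u (c + b0) *
    det (mat m m (\<lambda>(a, b). Y $$ (r + a, c + (if b < b0 then b else Suc b) - 1)))"
proof -
  define A where "A = mat (Suc m) (Suc m) (\<lambda>(a, b). Y $$ (r + a - 1, c + b - 1))"
  \<comment> \<open>Left multiplication by \<open>U\<close> performs the row replacement;
    \<open>u r = 1\<close> makes \<open>U\<close> unit triangular.\<close>
  define U where "U = mat (Suc m) (Suc m)
    (\<lambda>(a, b). if a = 0 then u (r + b) else if a = b then 1 else (0::real))"
  define B where "B = mat (Suc m) (Suc m)
    (\<lambda>(a, b). if a = 0 then pairing n Y u (c + b) else Y $$ (r + a - 1, c + b - 1))"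
  have A: "A \<in> carrier_mat (Suc m) (Suc m)" and U: "U \<in> carrier_mat (Suc m) (Suc m)"
    and B: "B \<in> carrier_mat (Suc m) (Suc m)"
    by (auto simp: A_def U_def B_def)
  have "upper_triangular U"
    by (auto simp: U_def)
  then have "det U = prod_list (diag_mat U)"
    using U by (rule det_upper_triangular)
  also have "diag_mat U = map (\<lambda>i. 1) [0..<Suc m]"
    unfolding diag_mat_def using u(2) by (intro map_cong) (auto simp: U_def)
  finally have detU: "det U = 1"
    by (simp add: map_replicate_const)
  have "U * A = B"
  proof (rule eq_matI)
    fix a b assume "a < dim_row B" "b < dim_col B"
    then have ab: "a < Suc m" "b < Suc m" by (auto simp: B_def)
    then have "(U * A) $$ (a, b) = (\<Sum>i<Suc m. U $$ (a, i) * A $$ (i, b))"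
      using A U by (simp add: scalar_prod_def atLeast0LessThan)
    also have "\<dots> = B $$ (a, b)"
    proof (cases "a = 0")
      case True
      have "pairing n Y u (c + b) = (\<Sum>i<Suc m. u (r + i) * Y $$ (r + i - 1, c + b - 1))"
        unfolding pairing_def by (rule sum_interval_shift) (use u(1) r in auto)
      with True ab show ?thesis
        by (simp add: U_def A_def B_def)
    next
      case False
      then have "(\<Sum>i<Suc m. U $$ (a, i) * A $$ (i, b)) = U $$ (a, a) * A $$ (a, b)"
        using ab by (intro sum_eq_single) (auto simp: U_def)
      with False ab show ?thesis
        by (simp add: U_def A_def B_def)
    qed
    finally show "(U * A) $$ (a, b) = B $$ (a, b)" .
  qed (auto simp: A_def U_def B_def)
  then have "det A = det B"
    using det_mult[OF U A] detU by simp
  also have "det B = (\<Sum>j<Suc m. B $$ (0, j) * cofactor B 0 j)"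
    by (rule laplace_expansion_row[OF B]) simp
  also have "\<dots> = B $$ (0, b0) * cofactor B 0 b0"
    using b0 zero by (intro sum_eq_single) (auto simp: B_def)
  also have "mat_delete B 0 b0
      = mat m m (\<lambda>(a, b). Y $$ (r + a, c + (if b < b0 then b else Suc b) - 1))"
    by (intro eq_matI) (auto simp: mat_delete_def B_def)
  then have "B $$ (0, b0) * cofactor B 0 b0 = (-1) ^ b0 * pairing n Y u (c + b0) *
    det (mat m m (\<lambda>(a, b). Y $$ (r + a, c + (if b < b0 then b else Suc b) - 1)))"
    using b0 by (simp add: cofactor_def B_def)
  finally show ?thesis
    by (simp add: interval_minor_def A_def)
qed

lemma interval_minor_principal:
  assumes "fwd_orth n \<rho> Y k m" "1 \<le> k" "k + m \<le> n"
  shows "interval_minor Y k k (Suc m)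
    = pairing n Y (fwd \<rho> k m) k * interval_minor Y (Suc k) (Suc k) m"
  using interval_minor_expand[of k m "fwd \<rho> k m" n 0 Y k] assms fwd_bwd_support(1)[of _ k m \<rho>]
  by (simp add: fwd_orth_def interval_minor_def)

text \<open>The columns are shifted by one, so the only one that may survive pairing with
  \<open>f\<close> is the last, at position \<open>m\<close>. This explains the sign in
  \<open>reflection\<close>.\<close>

lemma interval_minor_almost_principal:
  assumes "fwd_orth n \<rho> Y k m" "1 \<le> k" "k + m \<le> n"
  shows "interval_minor Y k (Suc k) (Suc m)
    = (-1) ^ m * pairing n Y (fwd \<rho> k m) (Suc (k + m)) * interval_minor Y (Suc k) (Suc k) m"
proof -
  have "mat m m (\<lambda>(a, b). Y $$ (k + a, Suc k + (if b < m then b else Suc b) - 1))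
      = mat m m (\<lambda>(a, b). Y $$ (Suc k + a - 1, Suc k + b - 1))"
    by (intro eq_matI) auto
  then show ?thesis
    using interval_minor_expand[of k m "fwd \<rho> k m" n m Y "Suc k"] assms fwd_bwd_support(1)[of _ k m \<rho>]
    by (simp add: fwd_orth_def interval_minor_def)
qed

lemma interval_minor_iprod:
  assumes sym: "unit_symmetric n Y"
  shows "1 \<le> k \<Longrightarrow> k + m \<le> n \<Longrightarrow> cube_on \<rho> k m \<Longrightarrow> compat_on n \<rho> Y k m \<Longrightarrow>
    interval_minor Y k k (Suc m) = iprod \<rho> k (Suc m)"
proof (induction m arbitrary: k)
  case 0
  then show ?case
    using sym by (simp add: interval_minor_def det_single unit_symmetric_def)
next
  case (Suc m)
  have "cube_on \<rho> (Suc k) m" "compat_on n \<rho> Y (Suc k) m"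
    using Suc.prems by (auto simp: cube_on_def compat_on_def)
  with Suc have IH: "interval_minor Y (Suc k) (Suc k) (Suc m) = iprod \<rho> (Suc k) (Suc m)"
    by auto
  have "fwd_orth n \<rho> Y k (Suc m)"
    using compat_imp_orth[OF sym Suc.prems] by blast
  moreover have "iprod \<rho> (Suc k) (Suc m) > 0"
    using cube_on_iprod_pos[OF Suc.prems(3)] by auto
  ultimately show ?case
    using interval_minor_principal[of n \<rho> Y k "Suc m"] Suc.prems IH by (simp add: fwd_orth_def)
qed

text \<open>The bridge between minors and residuals. Compatibility is assumed on the two shorter
  intervals only, so the lemma serves both directions: from correlations to compatibility and
  back.\<close>

lemma partial_corr_connected:
  assumes Y: "Y \<in> carrier_mat n n" "unit_symmetric n Y" and k: "1 \<le> k" "Suc (k + m) \<le> n"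
    and cube: "cube_on \<rho> k m" "cube_on \<rho> (Suc k) m"
    and compat: "compat_on n \<rho> Y k m" "compat_on n \<rho> Y (Suc k) m"
  shows "partial_corr Y k (Suc (k + m)) {k + 1..Suc (k + m) - 1} = \<rho> (k, Suc (k + m)) \<longleftrightarrow>
    pairing n Y (fwd \<rho> k m) (Suc (k + m)) = reflection \<rho> k m"
proof -
  let ?p = "pairing n Y (fwd \<rho> k m) (Suc (k + m))"
  let ?s = "sqrt (iprod \<rho> k (Suc m) * iprod \<rho> (Suc k) (Suc m))"
  have pos: "iprod \<rho> k (Suc m) > 0" "iprod \<rho> (Suc k) (Suc m) > 0" "iprod \<rho> (Suc k) m > 0"
    using cube_on_iprod_pos[OF cube(1), of k "Suc m"] cube_on_iprod_pos[OF cube(2)] by auto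
  then have s: "?s > 0" by simp
  have sets: "insert k {k + 1..Suc (k + m) - 1} = {k..<k + Suc m}"
    "insert (Suc (k + m)) {k + 1..Suc (k + m) - 1} = {Suc k..<Suc k + Suc m}"
    by auto
  \<comment> \<open>For \<open>m = 0\<close> the inner interval is empty, a case outside
    \<open>interval_minor_iprod\<close>.\<close>
  have inner: "interval_minor Y (Suc k) (Suc k) m = iprod \<rho> (Suc k) m"
  proof (cases m)
    case 0
    then show ?thesis by (simp add: interval_minor_def)
  next
    case (Suc d)
    have "cube_on \<rho> (Suc k) d" "compat_on n \<rho> Y (Suc k) d"
      using cube(2) compat(2) Suc by (auto simp: cube_on_def compat_on_def)
    then show ?thesis
      using interval_minor_iprod[OF Y(2), of "Suc k" d \<rho>] Suc k by simp
  qed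
  have "fwd_orth n \<rho> Y k m"
    using compat_imp_orth[OF Y(2) k(1) _ cube(1) compat(1)] k by simp
  then have "interval_minor Y k (Suc k) (Suc m) = (-1) ^ m * ?p * iprod \<rho> (Suc k) m"
    using interval_minor_almost_principal[of n \<rho> Y k m] inner k by simp
  moreover have "interval_minor Y k k (Suc m) = iprod \<rho> k (Suc m)"
    using interval_minor_iprod[OF Y(2) k(1) _ cube(1) compat(1)] k by simp
  moreover have "interval_minor Y (Suc k) (Suc k) (Suc m) = iprod \<rho> (Suc k) (Suc m)"
    using interval_minor_iprod[OF Y(2) _ _ cube(2) compat(2)] k by simp
  ultimately have "partial_corr Y k (Suc (k + m)) {k + 1..Suc (k + m) - 1}
      = (-1) ^ m * ?p * iprod \<rho> (Suc k) m / ?s"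
    using k minor_interval[OF Y(1), of k k "Suc m"] minor_interval[OF Y(1), of k "Suc k" "Suc m"]
      minor_interval[OF Y(1), of "Suc k" "Suc k" "Suc m"]
    by (simp only: partial_corr_def sets)
  moreover have "(-1) ^ m * x = y \<longleftrightarrow> x = (-1) ^ m * y" for x y :: real
    by (cases "even m") auto
  from this[of "?p * iprod \<rho> (Suc k) m" "\<rho> (k, Suc (k + m)) * ?s"]
  have "(-1) ^ m * ?p * iprod \<rho> (Suc k) m / ?s = \<rho> (k, Suc (k + m)) \<longleftrightarrow> ?p = reflection \<rho> k m"
    using s pos by (simp add: reflection_def divide_eq_eq eq_divide_eq mult.assoc del: real_sqrt_mult)
  ultimately show ?thesis by simp
qed


section \<open>Positive definiteness\<close>

definition quad :: "nat \<Rightarrow> real mat \<Rightarrow> (nat \<Rightarrow> real) \<Rightarrow> real" where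
  "quad n Y u = (\<Sum>j=1..n. u j * pairing n Y u j)"

lemma pos_def_mat_iff_quad:
  assumes Y: "Y \<in> carrier_mat n n"
  shows "pos_def_mat n Y \<longleftrightarrow> (\<forall>u. (\<exists>i\<in>{1..n}. u i \<noteq> 0) \<longrightarrow> quad n Y u > 0)"
proof -
  have eq: "v \<bullet> (Y *\<^sub>v v) = quad n Y u"
    if v: "v \<in> carrier_vec n" and u: "\<And>i. i < n \<Longrightarrow> u (Suc i) = v $ i" for u v
  proof -
    have "v \<bullet> (Y *\<^sub>v v) = (\<Sum>i<n. v $ i * (\<Sum>j<n. Y $$ (i, j) * v $ j))"
      using Y v by (simp add: scalar_prod_def atLeast0LessThan)
    also have "\<dots> = (\<Sum>i<n. \<Sum>j<n. v $ i * (Y $$ (i, j) * v $ j))"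
      by (simp add: sum_distrib_left)
    also have "\<dots> = (\<Sum>j<n. \<Sum>i<n. v $ i * (Y $$ (i, j) * v $ j))"
      by (rule sum.swap)
    also have "\<dots> = (\<Sum>j<n. u (Suc j) * (\<Sum>i<n. u (Suc i) * Y $$ (i, j)))"
      using u by (simp add: sum_distrib_left mult_ac)
    also have "\<dots> = quad n Y u"
      unfolding quad_def pairing_def
      by (simp add: sum.atLeast1_atMost_eq)
    finally show ?thesis .
  qed
  show ?thesis
  proof
    assume pd: "pos_def_mat n Y"
    show "\<forall>u. (\<exists>i\<in>{1..n}. u i \<noteq> 0) \<longrightarrow> quad n Y u > 0"
    proof (intro allI impI)
      fix u :: "nat \<Rightarrow> real" assume "\<exists>i\<in>{1..n}. u i \<noteq> 0"
      then obtain i where i: "1 \<le> i" "i \<le> n" "u i \<noteq> 0" by auto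
      define v where "v = vec n (\<lambda>i. u (Suc i))"
      have "v $ (i - 1) \<noteq> 0\<^sub>v n $ (i - 1)"
        using i by (cases i) (auto simp: v_def)
      then have "v \<noteq> 0\<^sub>v n" by auto
      then show "quad n Y u > 0"
        using pd eq[of v u] by (auto simp: pos_def_mat_def v_def)
    qed
  next
    assume pos: "\<forall>u. (\<exists>i\<in>{1..n}. u i \<noteq> 0) \<longrightarrow> quad n Y u > 0"
    show "pos_def_mat n Y"
      unfolding pos_def_mat_def
    proof (intro ballI impI)
      fix v :: "real vec" assume v: "v \<in> carrier_vec n" "v \<noteq> 0\<^sub>v n"
      then obtain i where i: "i < n" "v $ i \<noteq> 0"
        by (metis carrier_vecD eq_vecI index_zero_vec(1) index_zero_vec(2))
      then have "\<exists>i\<in>{1..n}. v $ (i - 1) \<noteq> 0"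
        by (intro bexI[of _ "Suc i"]) auto
      then show "v \<bullet> (Y *\<^sub>v v) > 0"
        using pos eq[of v "\<lambda>i. v $ (i - 1)"] v by auto
    qed
  qed
qed

text \<open>The forward residuals of the intervals \<open>{k..n}\<close> form an orthogonal basis.\<close>

lemma compat_imp_quad_pos:
  assumes sym: "unit_symmetric n Y" and cube: "cube_on \<rho> 1 (n - 1)" and compat: "compat_on n \<rho> Y 1 (n - 1)"
  shows "d \<le> n \<Longrightarrow> (\<And>i. i \<in> {1..n - d} \<Longrightarrow> u i = 0) \<Longrightarrow> \<exists>i\<in>{1..n}. u i \<noteq> 0 \<Longrightarrow> quad n Y u > 0"
proof (induction d arbitrary: u)
  case 0
  then show ?case by auto
next
  case (Suc d)
  \<comment> \<open>The first index at which \<open>u\<close> may be nonzero.\<close>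
  define k where "k = n - d"
  have k: "1 \<le> k" "k + d = n" using Suc.prems by (auto simp: k_def)
  have cube_k: "cube_on \<rho> k d" and compat_k: "compat_on n \<rho> Y k d"
    using cube compat k by (auto simp: cube_on_def compat_on_def)
  have orth: "fwd_orth n \<rho> Y k d"
    using compat_imp_orth[OF sym k(1) _ cube_k compat_k] k by auto
  define p where "p = pairing n Y (fwd \<rho> k d) k"
  have p: "p > 0"
    using orth cube_on_iprod_pos[OF cube_k, of k "Suc d"] cube_on_iprod_pos[OF cube_k, of "Suc k" d]
    by (simp add: fwd_orth_def p_def)
  \<comment> \<open>Removes the component along the residual of \<open>{k..n}\<close>, whose
    coefficient at \<open>k\<close> is 1; hence \<open>w\<close> vanishes up to
    \<open>k\<close>.\<close>
  define w where "w = (\<lambda>i. u i - u k * fwd \<rho> k d i)"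
  have u0: "u i = 0" if "1 \<le> i" "i < k" for i
    using Suc.prems(2)[of i] that k by auto
  have w0: "w i = 0" if "1 \<le> i" "i \<le> k" for i
    using that u0[of i] fwd_bwd_support(1)[of i k d \<rho>] by (cases "i = k") (auto simp: w_def)
  have pw: "pairing n Y u j = pairing n Y w j + u k * pairing n Y (fwd \<rho> k d) j" for j
    by (simp add: w_def pairing_diff)
  have "(\<Sum>j=1..n. u j * pairing n Y (fwd \<rho> k d) j) = u k * p"
    unfolding p_def using orth k u0
    by (intro sum_eq_single) (auto simp: fwd_orth_def, metis linorder_neqE_nat)
  moreover have "(\<Sum>j=1..n. w j * pairing n Y (fwd \<rho> k d) j) = 0"
    using orth k w0 by (intro sum.neutral ballI) (auto simp: fwd_orth_def, metis not_le)
  moreover have "(\<Sum>j=1..n. u j * pairing n Y w j) = (\<Sum>j=1..n. w j * pairing n Y u j)"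
    by (rule pairing_commute[OF sym])
  moreover have "quad n Y u = (\<Sum>j=1..n. u j * pairing n Y w j)
      + u k * (\<Sum>j=1..n. u j * pairing n Y (fwd \<rho> k d) j)"
    unfolding quad_def sum_distrib_left sum.distrib[symmetric]
    by (intro sum.cong refl) (simp add: pw algebra_simps)
  moreover have "(\<Sum>j=1..n. w j * pairing n Y u j) = quad n Y w
      + u k * (\<Sum>j=1..n. w j * pairing n Y (fwd \<rho> k d) j)"
    unfolding quad_def sum_distrib_left sum.distrib[symmetric]
    by (intro sum.cong refl) (simp add: pw algebra_simps)
  ultimately have q: "quad n Y u = quad n Y w + (u k)\<^sup>2 * p"
    by (simp add: power2_eq_square algebra_simps)
  show ?case
  proof (cases "\<exists>i\<in>{1..n}. w i \<noteq> 0")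
    case True
    have "quad n Y w > 0"
      by (rule Suc.IH) (use Suc.prems(1) True w0 k_def in auto)
    then show ?thesis
      using q p by (simp add: add_pos_nonneg)
  next
    case False
    then have "quad n Y w = 0" by (simp add: quad_def)
    moreover have "u k \<noteq> 0"
      using Suc.prems(3) False by (auto simp: w_def)
    ultimately show ?thesis
      using q p by simp
  qed
qed


section \<open>Path sums\<close>

definition turn :: "(nat \<Rightarrow> nat \<Rightarrow> real) \<Rightarrow> (nat set \<Rightarrow> real) \<Rightarrow> nat \<times> nat \<Rightarrow> nat \<times> nat \<Rightarrow> nat \<times> nat \<Rightarrow> real" where
  "turn a p u v w =
     (if snd u < snd v \<and> snd w < snd v then a (lo v) (hi v) / p {lo v + 1..hi v - 1} else 1) *
     ((if snd v < snd u \<and> snd v < snd w \<and> 1 \<le> snd v then a (lo v) (hi v) else 1) /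
      (if snd v < snd u \<and> snd v < snd w
       then p {lo (fst v, snd v + 2) + 1..hi (fst v, snd v + 2) - 1} else 1))"

fun turns :: "(nat \<Rightarrow> nat \<Rightarrow> real) \<Rightarrow> (nat set \<Rightarrow> real) \<Rightarrow> (nat \<times> nat) list \<Rightarrow> real" where
  "turns a p (u # v # w # C) = turn a p u v w * turns a p (v # w # C)"
| "turns a p _ = 1"

lemma turns_eq_prod:
  "turns a p C = (\<Prod>t<length C - 2. turn a p (C ! t) (C ! (t + 1)) (C ! (t + 2)))"
proof (induction a p C rule: turns.induct)
  case (1 a p u v w C)
  then show ?case
    by (simp add: prod.lessThan_Suc_shift del: prod.lessThan_Suc)
qed auto

text \<open>Maxima and minima are recognised from three consecutive vertices, so the weight can be
  unrolled from the start of the path.\<close>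

lemma weight_eq_turns: "weight a p C = turns a p C"
proof -
  define A where "A = (\<lambda>t. a (lo (C ! t)) (hi (C ! t)))"
  define P where "P = (\<lambda>v. p {lo v + 1..hi v - 1})"
  define T where "T = {0<..<length C - 1}"
  have fin: "finite T" by (simp add: T_def)
  define up where "up = (\<lambda>t. snd (C ! (t - 1)) < snd (C ! t) \<and> snd (C ! (t + 1)) < snd (C ! t))"
  define dn where "dn = (\<lambda>t. snd (C ! t) < snd (C ! (t - 1)) \<and> snd (C ! t) < snd (C ! (t + 1)))"
  have maxs: "loc_maxs C = {t \<in> T. up t}" and mins: "loc_mins C = {t \<in> T. dn t}"
    by (auto simp: loc_maxs_def loc_mins_def T_def up_def dn_def)
  have mins': "{t \<in> loc_mins C. 1 \<le> snd (C ! t)} = {t \<in> T. dn t \<and> 1 \<le> snd (C ! t)}"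
    using mins by auto
  have "weight a p C = (\<Prod>t\<in>{t \<in> T. up t}. A t / P (C ! t)) *
      ((\<Prod>t\<in>{t \<in> T. dn t \<and> 1 \<le> snd (C ! t)}. A t) /
       (\<Prod>t\<in>{t \<in> T. dn t}. P (fst (C ! t), snd (C ! t) + 2)))"
    by (simp add: weight_def maxs mins mins' A_def P_def del: One_nat_def)
  also have "\<dots> = (\<Prod>t\<in>T. (if up t then A t / P (C ! t) else 1) *
      ((if dn t \<and> 1 \<le> snd (C ! t) then A t else 1) /
       (if dn t then P (fst (C ! t), snd (C ! t) + 2) else 1)))"
    by (simp only: prod.inter_filter[OF fin] prod.distrib prod_dividef[symmetric])
  also have "\<dots> = (\<Prod>t\<in>T. turn a p (C ! (t - 1)) (C ! t) (C ! (t + 1)))"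
    by (intro prod.cong refl) (simp add: turn_def A_def P_def up_def dn_def)
  also have "\<dots> = (\<Prod>t<length C - 2. turn a p (C ! t) (C ! (t + 1)) (C ! (t + 2)))"
    by (rule prod.reindex_bij_witness[of _ Suc "\<lambda>t. t - 1"]) (auto simp: T_def)
  finally show ?thesis
    by (simp add: turns_eq_prod)
qed

text \<open>The vertex labelled by the interval \<open>{k..k + m}\<close>.\<close>

definition vertex :: "nat \<Rightarrow> nat \<Rightarrow> nat \<times> nat" where
  "vertex k m = (2 * k + m - 2, m)"

lemma lo_hi_vertex [simp]: "1 \<le> k \<Longrightarrow> lo (vertex k m) = k" "1 \<le> k \<Longrightarrow> hi (vertex k m) = k + m"
  by (auto simp: lo_def hi_def vertex_def)

lemma fst_snd_vertex [simp]: "fst (vertex k m) = 2 * k + m - 2" "snd (vertex k m) = m"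
  by (auto simp: vertex_def)

text \<open>On interval labels, a step up appends an index on the right and a step down removes the
  leftmost index.\<close>

lemma grid_edge_vertex:
  assumes "1 \<le> k"
  shows "grid_edge (vertex k m) w \<longleftrightarrow> w = vertex k (Suc m) \<or> (m > 0 \<and> w = vertex (Suc k) (m - 1))"
  using assms by (cases w) (auto simp: grid_edge_def vertex_def)

section \<open>Paths to node \<open>j\<close> from an arbitrary vertex\<close>

definition paths_from :: "nat \<Rightarrow> nat \<Rightarrow> nat \<times> nat \<Rightarrow> (nat \<times> nat) list set" where
  "paths_from n j v =
     {C. C \<noteq> [] \<and> hd C = v \<and> last C = node j \<and> set C \<subseteq> grid_vertices n \<and> successively grid_edge C}"

text \<open>The first coordinate grows by 1 at each step, and the sum of the coordinates, which
  encodes the right end of the interval, never decreases.\<close>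

lemma grid_path_last:
  "successively grid_edge C \<Longrightarrow> C \<noteq> [] \<Longrightarrow>
    fst (last C) + 1 = fst (hd C) + length C \<and> fst (hd C) + snd (hd C) \<le> fst (last C) + snd (last C)"
  by (induction C) (auto simp: successively_Cons grid_edge_def)

lemma finite_paths_from: "finite (paths_from n j v)"
proof (rule finite_subset)
  show "paths_from n j v \<subseteq> {C. set C \<subseteq> grid_vertices n \<and> length C \<le> 2 * j + 1}"
    using grid_path_last by (fastforce simp: paths_from_def node_def)
  have "finite (grid_vertices n)"
    by (rule finite_subset[of _ "{..2 * n} \<times> {..2 * n}"]) (auto simp: grid_vertices_def)
  then show "finite {C. set C \<subseteq> grid_vertices n \<and> length C \<le> 2 * j + 1}"
    by (rule finite_lists_length_le)
qed

lemma paths_from_empty: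
  assumes "1 \<le> k" "1 \<le> j" "j < k + m"
  shows "paths_from n j (vertex k m) = {}"
proof -
  have False if "C \<in> paths_from n j (vertex k m)" for C
    using grid_path_last[of C] that assms by (auto simp: paths_from_def node_def)
  then show ?thesis by blast
qed

lemma paths_from_node:
  assumes "1 \<le> j" "j \<le> n"
  shows "paths_from n j (vertex j 0) = {[vertex j 0]}"
proof (intro equalityI subsetI)
  fix C assume C: "C \<in> paths_from n j (vertex j 0)"
  then have "length C = 1"
    using grid_path_last[of C] assms by (auto simp: paths_from_def node_def)
  with C show "C \<in> {[vertex j 0]}"
    by (auto simp: paths_from_def length_Suc_conv)
next
  fix C assume "C \<in> {[vertex j 0]}"
  then show "C \<in> paths_from n j (vertex j 0)"
    using assms by (auto simp: paths_from_def node_def grid_vertices_def vertex_def)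
qed

lemma paths_from_step:
  assumes k: "1 \<le> k" "k + m \<le> j" "j \<le> n" and ne: "\<not> (k = j \<and> m = 0)"
  shows "paths_from n j (vertex k m) = (#) (vertex k m) ` (paths_from n j (vertex k (Suc m)) \<union>
    (if m > 0 then paths_from n j (vertex (Suc k) (m - 1)) else {}))"
proof -
  have v: "vertex k m \<in> grid_vertices n" "vertex k m \<noteq> node j"
    using k ne by (auto simp: vertex_def grid_vertices_def node_def)
  show ?thesis
  proof (intro equalityI subsetI)
    fix C assume "C \<in> paths_from n j (vertex k m)"
    with v obtain C' where "C = vertex k m # C'" "C' \<noteq> []" "last C' = node j"
      "set C' \<subseteq> grid_vertices n" "grid_edge (vertex k m) (hd C')" "successively grid_edge C'"
      unfolding paths_from_def by (cases C) (auto simp: successively_Cons split: if_splits)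
    then show "C \<in> (#) (vertex k m) ` (paths_from n j (vertex k (Suc m)) \<union>
        (if m > 0 then paths_from n j (vertex (Suc k) (m - 1)) else {}))"
      using grid_edge_vertex[OF k(1)] by (auto simp: paths_from_def)
  next
    fix C assume "C \<in> (#) (vertex k m) ` (paths_from n j (vertex k (Suc m)) \<union>
        (if m > 0 then paths_from n j (vertex (Suc k) (m - 1)) else {}))"
    moreover have "grid_edge (vertex k m) (vertex k (Suc m))"
      "m > 0 \<Longrightarrow> grid_edge (vertex k m) (vertex (Suc k) (m - 1))"
      using grid_edge_vertex[OF k(1)] by blast+
    ultimately show "C \<in> paths_from n j (vertex k m)"
      using v by (auto simp: paths_from_def successively_Cons split: if_splits)
  qed
qed

text \<open>The predecessor \<open>u\<close> is prefixed so that the turn at \<open>v\<close> is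
  counted: whether \<open>v\<close> is a peak, a valley or straight depends on how it was
  reached.\<close>

definition path_sum where
  "path_sum \<rho> n j u v = (\<Sum>C\<in>paths_from n j v. turns (A_of \<rho>) (P_of \<rho>) (u # C))"

lemma sum_turns_Cons:
  "(\<Sum>C\<in>paths_from n j w. turns (A_of \<rho>) (P_of \<rho>) (u # v # C))
    = turn (A_of \<rho>) (P_of \<rho>) u v w * path_sum \<rho> n j v w"
  unfolding path_sum_def sum_distrib_left
proof (rule sum.cong[OF refl])
  fix C assume "C \<in> paths_from n j w"
  then obtain C' where "C = w # C'"
    by (cases C) (auto simp: paths_from_def)
  then show "turns (A_of \<rho>) (P_of \<rho>) (u # v # C)
      = turn (A_of \<rho>) (P_of \<rho>) u v w * turns (A_of \<rho>) (P_of \<rho>) (v # C)"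
    by simp
qed

lemma path_sum_step_0:
  assumes "1 \<le> k" "k < j" "j \<le> n"
  shows "path_sum \<rho> n j u (vertex k 0)
    = turn (A_of \<rho>) (P_of \<rho>) u (vertex k 0) (vertex k 1) * path_sum \<rho> n j (vertex k 0) (vertex k 1)"
  using paths_from_step[of k 0 j n] assms
  by (simp add: path_sum_def[of _ _ _ u] sum.reindex sum_turns_Cons)

lemma path_sum_step_Suc:
  assumes "1 \<le> k" "k + Suc m \<le> j" "j \<le> n"
  defines "v \<equiv> vertex k (Suc m)"
  shows "path_sum \<rho> n j u v
    = turn (A_of \<rho>) (P_of \<rho>) u v (vertex k (Suc (Suc m))) * path_sum \<rho> n j v (vertex k (Suc (Suc m)))
    + turn (A_of \<rho>) (P_of \<rho>) u v (vertex (Suc k) m) * path_sum \<rho> n j v (vertex (Suc k) m)"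
proof -
  have "paths_from n j (vertex k (Suc (Suc m))) \<inter> paths_from n j (vertex (Suc k) m) = {}"
    by (auto simp: paths_from_def vertex_def)
  then show ?thesis
    using paths_from_step[of k "Suc m" j n] assms
    by (simp add: path_sum_def[of _ _ _ u] sum.reindex sum_turns_Cons sum.union_disjoint
        finite_paths_from)
qed

section \<open>Signs and the weights of peaks and valleys\<close>

lemma neg_one_power_half_mult:
  "(-1) ^ (Suc m div 2) * (-1) ^ (m div 2) = ((-1) ^ m :: real)"
proof -
  have "Suc m div 2 + m div 2 = m" by linarith
  then show ?thesis by (metis power_add)
qed

lemma A_of_interval:
  "A_of \<rho> k (Suc (k + m)) = (-1) ^ (Suc m div 2) * \<rho> (k, Suc (k + m)) *
     sqrt (iprod \<rho> k (Suc m) * iprod \<rho> (Suc k) (Suc m))"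
proof -
  have sets: "{k..Suc (k + m) - 1} = {k..<k + Suc m}" "{k + 1..Suc (k + m)} = {Suc k..<Suc k + Suc m}"
    by auto
  have c: "nat \<lceil>real m / 2\<rceil> = Suc m div 2"
  proof -
    have "\<lceil>real m / 2\<rceil> = int (Suc m div 2)"
      by (rule ceiling_unique) linarith+
    then show ?thesis by simp
  qed
  \<comment> \<open>The two intervals under the root have equal length, so their signs
    cancel.\<close>
  have "((-1) ^ x * (s::real)) * ((-1) ^ x * t) = s * t" for x :: nat and s t
    by (cases "even x") auto
  then show ?thesis
    unfolding A_of_def sets P_of_interval using c by simp
qed

lemma turn_peak:
  assumes "1 \<le> k"
  shows "turn (A_of \<rho>) (P_of \<rho>) (vertex k m) (vertex k (Suc m)) (vertex (Suc k) m) = reflection \<rho> k m"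
proof -
  have "{k + 1..k + Suc m - 1} = {Suc k..<Suc k + m}" by auto
  then have "turn (A_of \<rho>) (P_of \<rho>) (vertex k m) (vertex k (Suc m)) (vertex (Suc k) m)
      = A_of \<rho> k (Suc (k + m)) / P_of \<rho> {Suc k..<Suc k + m}"
    using assms by (simp add: turn_def)
  also have "\<dots> = ((-1) ^ (Suc m div 2) / (-1) ^ (m div 2)) * \<rho> (k, Suc (k + m)) *
     sqrt (iprod \<rho> k (Suc m) * iprod \<rho> (Suc k) (Suc m)) / iprod \<rho> (Suc k) m"
    unfolding A_of_interval P_of_interval by simp
  also have "(-1) ^ (Suc m div 2) / (-1) ^ (m div 2) = ((-1) ^ m :: real)"
    using neg_one_power_half_mult[of m] by (cases "even (m div 2)") auto
  finally show ?thesis by (simp add: reflection_def)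
qed

text \<open>The vertex above is \<open>vertex k 2\<close>, whose inner interval is a single index,
  so \<open>P_of\<close> is 1: passing through an intermediate node costs nothing.\<close>

lemma turn_valley_0:
  assumes "1 \<le> k"
  shows "turn (A_of \<rho>) (P_of \<rho>) (vertex k 1) (vertex (Suc k) 0) (vertex (Suc k) 1) = 1"
proof -
  have "vertex k 2 = (2 * k, 2)" by (simp add: vertex_def)
  then have *: "lo (2 * k, 2) = k" "hi (2 * k, 2) = k + 2"
    using lo_hi_vertex[OF assms, of 2] by simp_all
  have "{k + 1..k + 2 - 1} = {Suc k..<Suc k + 1}" by auto
  then have "P_of \<rho> {k + 1..k + 2 - 1} = 1"
    by (simp only: P_of_interval) simp
  then show ?thesis
    using * by (simp add: turn_def numeral_2_eq_2)
qed

text \<open>The interior of the interval of the vertex above is the interval of the minimum itself.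
  It has two indices more than the interior used in \<open>turn_peak\<close>, whence the extra minus
  sign.\<close>

lemma turn_valley_Suc:
  assumes "1 \<le> k" "iprod \<rho> (Suc (Suc k)) m > 0"
  shows "turn (A_of \<rho>) (P_of \<rho>) (vertex k (Suc (Suc m))) (vertex (Suc k) (Suc m)) (vertex (Suc k) (Suc (Suc m)))
    = - co_reflection \<rho> (Suc k) m"
proof -
  have "(fst (vertex (Suc k) (Suc m)), snd (vertex (Suc k) (Suc m)) + 2) = vertex k (Suc (Suc (Suc m)))"
    by (simp add: vertex_def)
  moreover have "{k + 1..k + Suc (Suc (Suc m)) - 1} = {Suc k..<Suc k + Suc (Suc m)}" by auto
  ultimately have "turn (A_of \<rho>) (P_of \<rho>) (vertex k (Suc (Suc m))) (vertex (Suc k) (Suc m))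
      (vertex (Suc k) (Suc (Suc m)))
      = A_of \<rho> (Suc k) (Suc (Suc k + m)) / P_of \<rho> {Suc k..<Suc k + Suc (Suc m)}"
    using assms(1) by (simp add: turn_def del: fst_snd_vertex(1))
  also have "\<dots> = ((-1) ^ (Suc m div 2) / (-1) ^ (Suc (Suc m) div 2)) * \<rho> (Suc k, Suc (Suc k + m)) *
     sqrt (iprod \<rho> (Suc k) (Suc m) * iprod \<rho> (Suc (Suc k)) (Suc m)) / iprod \<rho> (Suc k) (Suc (Suc m))"
    unfolding A_of_interval P_of_interval by simp
  also have "(-1) ^ (Suc m div 2) / (-1) ^ (Suc (Suc m) div 2) = (- ((-1) ^ m) :: real)"
    using neg_one_power_half_mult[of m] by (cases "even (m div 2)") auto
  finally show ?thesis
    using assms(2) by (simp add: co_reflection_def reflection_def)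
qed

lemma turn_straight [simp]:
  "turn a p (vertex k m) (vertex k (Suc m)) (vertex k (Suc (Suc m))) = 1"
  "turn a p (vertex k (Suc (Suc m))) (vertex (Suc k) (Suc m)) (vertex (Suc (Suc k)) m) = 1"
  by (simp_all add: turn_def)

text \<open>The Levinson recursion read along a path: each equation splits the paths by their next
  step. \<open>N\<close> bounds the steps left from the first vertex of the step considered,
  \<open>2 * j - 2 * k - m\<close> for a step up and one less for a step down.\<close>

lemma path_sum_eq_pairing:
  assumes sym: "unit_symmetric n Y" and cube: "cube_on \<rho> 1 (n - 1)" and compat: "compat_on n \<rho> Y 1 (n - 1)"
    and j: "j \<le> n"
  shows "(1 \<le> k \<and> k < j \<and> k + m \<le> j \<and> 2 * j \<le> 2 * k + m + N \<longrightarrow>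
      path_sum \<rho> n j (vertex k m) (vertex k (Suc m)) = pairing n Y (fwd \<rho> k m) j) \<and>
    (1 \<le> k \<and> Suc (k + m) \<le> j \<and> 2 * j \<le> Suc (2 * k + m + N) \<longrightarrow>
      path_sum \<rho> n j (vertex k (Suc m)) (vertex (Suc k) m) = pairing n Y (bwd \<rho> (Suc k) m) j)"
proof (induction N arbitrary: k m)
  case 0
  then show ?case by auto
next
  case (Suc N)
  have orth: "fwd_orth n \<rho> Y i d" "bwd_orth n \<rho> Y i d" if "1 \<le> i" "i + d \<le> n" for i d
  proof -
    have "cube_on \<rho> i d" "compat_on n \<rho> Y i d"
      using that cube compat by (auto simp: cube_on_def compat_on_def)
    then show "fwd_orth n \<rho> Y i d" "bwd_orth n \<rho> Y i d"
      using compat_imp_orth[OF sym that] by auto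
  qed
  show ?case
  proof (intro conjI impI; (elim conjE)?)
    assume k: "1 \<le> k" "k < j" "k + m \<le> j" "2 * j \<le> 2 * k + m + Suc N"
    show "path_sum \<rho> n j (vertex k m) (vertex k (Suc m)) = pairing n Y (fwd \<rho> k m) j"
    proof (cases "k + m = j")
      \<comment> \<open>The step up overshoots: no path returns to node \<open>j\<close>, and
        correspondingly \<open>f\<close> is orthogonal to \<open>v\<^sub>j\<close>.\<close>
      case True
      then show ?thesis
        using paths_from_empty[of k j "Suc m" n] orth(1)[of k m] k j
        by (simp add: path_sum_def fwd_orth_def)
    next
      case False
      then have "path_sum \<rho> n j (vertex k m) (vertex k (Suc m))
          = pairing n Y (fwd \<rho> k (Suc m)) j + reflection \<rho> k m * pairing n Y (bwd \<rho> (Suc k) m) j"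
        using path_sum_step_Suc[of k m j n \<rho> "vertex k m"] k j Suc.IH[of k "Suc m"] Suc.IH[of k m]
        by (simp add: turn_peak)
      then show ?thesis
        by (simp add: pairing_fwd_Suc)
    qed
  next
    assume k: "1 \<le> k" "Suc (k + m) \<le> j" "2 * j \<le> Suc (2 * k + m + Suc N)"
    show "path_sum \<rho> n j (vertex k (Suc m)) (vertex (Suc k) m) = pairing n Y (bwd \<rho> (Suc k) m) j"
    proof (cases m)
      case 0
      \<comment> \<open>At a node both residuals are the vector itself, and the path ends there or
        goes up again.\<close>
      have unit: "pairing n Y (bwd \<rho> (Suc k) 0) j = pairing n Y (fwd \<rho> (Suc k) 0) j"
        using pairing_unit[of "Suc k" n Y \<rho> j] k j by simp
      show ?thesis
      proof (cases "Suc k = j")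
        case True
        then show ?thesis
          unfolding 0 using k j paths_from_node[of j n] orth(2)[of j 0] by (simp add: path_sum_def bwd_orth_def)
      next
        case False
        then have "path_sum \<rho> n j (vertex k 1) (vertex (Suc k) 0)
            = path_sum \<rho> n j (vertex (Suc k) 0) (vertex (Suc k) 1)"
          using path_sum_step_0[of "Suc k" j n \<rho> "vertex k 1"] k j turn_valley_0[OF k(1), of \<rho>] 0
          by simp
        then show ?thesis
          using False 0 k unit Suc.IH[of "Suc k" 0] by simp
      qed
    next
      case m: (Suc d)
      have "iprod \<rho> (Suc (Suc k)) d > 0"
        using cube_on_iprod_pos[OF cube, of "Suc (Suc k)" d] k j m by simp
      then have "path_sum \<rho> n j (vertex k (Suc m)) (vertex (Suc k) m)
          = - co_reflection \<rho> (Suc k) d * pairing n Y (fwd \<rho> (Suc k) m) j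
            + pairing n Y (bwd \<rho> (Suc (Suc k)) d) j"
        using path_sum_step_Suc[of "Suc k" d j n \<rho> "vertex k (Suc m)"] k j m
          Suc.IH[of "Suc k" m] Suc.IH[of "Suc k" d] turn_valley_Suc[of k \<rho> d]
        by simp
      then show ?thesis
        by (simp add: m pairing_bwd_Suc)
    qed
  qed
qed

lemma sum_catalan_paths:
  assumes sym: "unit_symmetric n Y" and cube: "cube_on \<rho> 1 (n - 1)" and compat: "compat_on n \<rho> Y 1 (n - 1)"
    and ij: "1 \<le> i" "i < j" "j \<le> n"
  shows "(\<Sum>C\<in>catalan_paths n i j. weight (A_of \<rho>) (P_of \<rho>) C) = Y $$ (i - 1, j - 1)"
proof -
  have "catalan_paths n i j = paths_from n j (vertex i 0)"
    by (simp add: catalan_paths_def paths_from_def node_def vertex_def)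
  also have "\<dots> = (#) (vertex i 0) ` paths_from n j (vertex i 1)"
    using paths_from_step[of i 0 j n] ij by simp
  finally have "(\<Sum>C\<in>catalan_paths n i j. weight (A_of \<rho>) (P_of \<rho>) C)
      = path_sum \<rho> n j (vertex i 0) (vertex i 1)"
    by (simp add: weight_eq_turns path_sum_def sum.reindex)
  also have "\<dots> = pairing n Y (fwd \<rho> i 0) j"
    using path_sum_eq_pairing[OF sym cube compat ij(3), of i 0 "2 * j"] ij by simp
  also have "\<dots> = Y $$ (i - 1, j - 1)"
    using ij by (intro pairing_unit) auto
  finally show ?thesis .
qed


lemma Psi_eq:
  assumes Y: "Y \<in> carrier_mat n n" and sym: "unit_symmetric n Y"
    and cube: "cube_on \<rho> 1 (n - 1)" and compat: "compat_on n \<rho> Y 1 (n - 1)"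
  shows "Psi n \<rho> = Y"
proof (rule eq_matI)
  fix i j assume "i < dim_row Y" "j < dim_col Y"
  with Y have ij: "i < n" "j < n" by auto
  have diag: "Y $$ (i, i) = 1"
    using sym ij unfolding unit_symmetric_def by (auto dest!: bspec[of _ _ "Suc i"])
  have "Y $$ (i, j) = Y $$ (j, i)"
    using sym ij unfolding unit_symmetric_def
    by (metis Suc_leI atLeastAtMost_iff diff_Suc_1 le_add1 plus_1_eq_Suc)
  moreover have "(\<Sum>C\<in>catalan_paths n (Suc i) (Suc j). weight (A_of \<rho>) (P_of \<rho>) C) = Y $$ (i, j)"
    if "i < j" "j < n" for i j
    using sum_catalan_paths[OF sym cube compat, of "Suc i" "Suc j"] that by simp
  ultimately show "Psi n \<rho> $$ (i, j) = Y $$ (i, j)"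
    using ij diag by (cases i j rule: linorder_cases) (auto simp: Psi_def min_def max_def)
qed (use Y in \<open>auto simp: Psi_def\<close>)


section \<open>Every parameter vector is realised\<close>

text \<open>\<open>entry_of \<rho> k m\<close> is the entry in row \<open>k\<close> and column \<open>k + m\<close>: the condition in
  \<^const>\<open>compat_on\<close> is affine in it, with leading coefficient 1.\<close>

fun entry_of :: "(nat \<times> nat \<Rightarrow> real) \<Rightarrow> nat \<Rightarrow> nat \<Rightarrow> real" where
  "entry_of \<rho> k 0 = 1"
| "entry_of \<rho> k (Suc m) =
    reflection \<rho> k m - (\<Sum>t<m. fwd \<rho> k m (k + Suc t) * entry_of \<rho> (k + Suc t) (m - t))"

definition realisation :: "nat \<Rightarrow> (nat \<times> nat \<Rightarrow> real) \<Rightarrow> real mat" where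
  "realisation n \<rho> = mat n n (\<lambda>(i, j). entry_of \<rho> (Suc (min i j)) (max i j - min i j))"

lemma realisation_carrier: "realisation n \<rho> \<in> carrier_mat n n"
  by (simp add: realisation_def)

lemma unit_symmetric_realisation: "unit_symmetric n (realisation n \<rho>)"
  by (auto simp: unit_symmetric_def realisation_def min.commute max.commute)

lemma compat_realisation: "compat_on n \<rho> (realisation n \<rho>) 1 (n - 1)"
  unfolding compat_on_def
proof (intro allI impI; elim conjE)
  fix k m assume k: "1 \<le> k" "k + m < 1 + (n - 1)"
  have "pairing n (realisation n \<rho>) (fwd \<rho> k m) (Suc (k + m))
      = (\<Sum>t<Suc m. fwd \<rho> k m (k + t) * realisation n \<rho> $$ (k + t - 1, Suc (k + m) - 1))"
    unfolding pairing_def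
    by (rule sum_interval_shift) (use k fwd_bwd_support in auto)
  also have "\<dots> = (\<Sum>t<Suc m. fwd \<rho> k m (k + t) * entry_of \<rho> (k + t) (Suc m - t))"
    using k by (intro sum.cong refl) (auto simp: realisation_def min_def max_def)
  \<comment> \<open>The summand \<open>t = 0\<close> has coefficient 1; all others involve entries
    closer to the diagonal.\<close>
  also have "\<dots> = entry_of \<rho> k (Suc m) + (\<Sum>t<m. fwd \<rho> k m (k + Suc t) * entry_of \<rho> (k + Suc t) (m - t))"
    by (simp only: sum.lessThan_Suc_shift) (simp del: entry_of.simps)
  finally show "pairing n (realisation n \<rho>) (fwd \<rho> k m) (Suc (k + m)) = reflection \<rho> k m"
    by simp
qed


section \<open>The bijection\<close>

lemma correlation_matsD:
  assumes "Y \<in> correlation_mats n"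
  shows "Y \<in> carrier_mat n n" "unit_symmetric n Y" "pos_def_mat n Y"
proof -
  from assms show Y: "Y \<in> carrier_mat n n" and "pos_def_mat n Y"
    by (auto simp: correlation_mats_def)
  have "Y $$ (i, j) = Y $$ (j, i)" if "i < n" "j < n" for i j
    using assms that Y by (auto simp: correlation_mats_def) (metis carrier_matD index_transpose_mat(1))
  then show "unit_symmetric n Y"
    using assms by (auto simp: unit_symmetric_def correlation_mats_def)
qed

lemma correlation_matsI:
  assumes "Y \<in> carrier_mat n n" "unit_symmetric n Y" "pos_def_mat n Y"
  shows "Y \<in> correlation_mats n"
proof -
  have "Y $$ (i, j) = Y $$ (j, i)" "Y $$ (i, i) = 1" if "i < n" "j < n" for i j
    using assms(2) that unfolding unit_symmetric_def
    by (metis Suc_leI atLeastAtMost_iff diff_Suc_1 le_add1 plus_1_eq_Suc)+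
  then show ?thesis
    using assms by (auto simp: correlation_mats_def intro!: eq_matI)
qed

text \<open>Both claims are proved together: the residual formulas divide by products that are
  positive by the cube condition on shorter intervals, and positive definiteness then bounds the new
  parameter.\<close>

lemma connected_partial_corrs_compat:
  assumes Y: "Y \<in> correlation_mats n"
  defines "\<rho> \<equiv> connected_partial_corrs n Y"
  shows "1 \<le> k \<Longrightarrow> k + m \<le> n \<Longrightarrow> cube_on \<rho> k m \<and> compat_on n \<rho> Y k m"
proof (induction m arbitrary: k)
  case 0
  then show ?case by (auto simp: cube_on_def compat_on_def)
next
  case (Suc m)
  note Y' = correlation_matsD[OF Y]
  have cube: "cube_on \<rho> k m" "cube_on \<rho> (Suc k) m"
    and compat: "compat_on n \<rho> Y k m" "compat_on n \<rho> Y (Suc k) m"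
    using Suc by auto
  have k: "1 \<le> k" "Suc (k + m) \<le> n" using Suc.prems by auto
  have "\<rho> (k, Suc (k + m)) = partial_corr Y k (Suc (k + m)) {k + 1..Suc (k + m) - 1}"
    using k by (simp add: \<rho>_def connected_partial_corrs_def index_pairs_def)
  then have c: "pairing n Y (fwd \<rho> k m) (Suc (k + m)) = reflection \<rho> k m"
    using partial_corr_connected[OF Y'(1,2) k cube compat] by simp
  \<comment> \<open>The bound at the outer pair \<open>(k, k + m + 1)\<close> is still open here;
    \<open>fwd_orth_Suc\<close> works from the two shorter intervals, and the norm it delivers
    yields that bound.\<close>
  have f: "fwd_orth n \<rho> Y k (Suc m)"
    using fwd_orth_Suc[OF Y'(2) k _ _ c cube] compat_imp_orth[OF Y'(2) _ _ cube(1) compat(1)]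
      compat_imp_orth[OF Y'(2) _ _ cube(2) compat(2)] k by auto
  have pos: "iprod \<rho> k (Suc m) > 0" "iprod \<rho> (Suc k) (Suc m) > 0" "iprod \<rho> (Suc k) m > 0"
    using cube_on_iprod_pos[OF cube(1), of k "Suc m"] cube_on_iprod_pos[OF cube(2)] by auto
  have "quad n Y (fwd \<rho> k (Suc m)) = fwd \<rho> k (Suc m) k * pairing n Y (fwd \<rho> k (Suc m)) k"
    unfolding quad_def
  proof (rule sum_eq_single)
    fix i assume "i \<in> {1..n}" "i \<noteq> k"
    then show "fwd \<rho> k (Suc m) i * pairing n Y (fwd \<rho> k (Suc m)) i = 0"
      using f fwd_bwd_support(1)[of i k "Suc m" \<rho>]
      by (cases "i \<in> {k..k + Suc m}") (auto simp: fwd_orth_def)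
  qed (use k in auto)
  also have "\<dots> = iprod \<rho> k (Suc (Suc m)) / iprod \<rho> (Suc k) (Suc m)"
    using f fwd_first[of \<rho> k "Suc m"] by (simp add: fwd_orth_def)
  finally have q: "quad n Y (fwd \<rho> k (Suc m)) = \<dots>" .
  have "\<exists>i\<in>{1..n}. fwd \<rho> k (Suc m) i \<noteq> 0"
    using fwd_first[of \<rho> k "Suc m"] k by (intro bexI[of _ k]) (auto)
  then have "quad n Y (fwd \<rho> k (Suc m)) > 0"
    using Y'(1,3) pos_def_mat_iff_quad by blast
  then have "iprod \<rho> k (Suc (Suc m)) > 0"
    using q pos by (simp add: zero_less_divide_iff)
  then have "iprod \<rho> k (Suc m) * iprod \<rho> (Suc k) (Suc m) * (1 - (\<rho> (k, Suc (k + m)))\<^sup>2) > 0"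
    using pos unfolding iprod_rec[symmetric] by simp
  then have "\<bar>\<rho> (k, Suc (k + m))\<bar> < 1"
    using pos by (metis abs_square_less_1 diff_gt_0_iff_gt mult_pos_pos zero_less_mult_pos)
  then have new: "\<rho> (k, Suc (k + m)) \<in> {-1<..<1}" by auto
  have "cube_on \<rho> k (Suc m)"
    unfolding cube_on_def
  proof (intro allI impI)
    fix i j assume ij: "k \<le> i \<and> i < j \<and> j \<le> k + Suc m"
    then consider "i = k" "j = Suc (k + m)" | "j \<le> k + m" | "Suc k \<le> i" by linarith
    then show "\<rho> (i, j) \<in> {-1<..<1}"
      using new cube ij by cases (auto simp: cube_on_def)
  qed
  moreover have "compat_on n \<rho> Y k (Suc m)"
    unfolding compat_on_def
  proof (intro allI impI)
    fix i d assume id: "k \<le> i \<and> i + d < k + Suc m"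
    then consider "i = k" "d = m" | "i + d < k + m" | "Suc k \<le> i" by linarith
    then show "pairing n Y (fwd \<rho> i d) (Suc (i + d)) = reflection \<rho> i d"
      using c compat id by cases (auto simp: compat_on_def)
  qed
  ultimately show ?case ..
qed

lemma connected_partial_corrs_cube:
  assumes "Y \<in> correlation_mats n"
  shows "connected_partial_corrs n Y \<in> rho_cube n"
proof -
  have "connected_partial_corrs n Y (i, j) \<in> {-1<..<1}" if "(i, j) \<in> index_pairs n" for i j
    using connected_partial_corrs_compat[OF assms, of i "j - i"] that
    by (auto simp: cube_on_def index_pairs_def)
  moreover have "connected_partial_corrs n Y \<in> extensional (index_pairs n)"
    by (simp add: connected_partial_corrs_def)
  ultimately show ?thesis
    by (auto simp: rho_cube_def PiE_def)
qed

lemma Psi_connected_partial_corrs: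
  assumes "Y \<in> correlation_mats n" "n \<ge> 1"
  shows "Psi n (connected_partial_corrs n Y) = Y"
  using connected_partial_corrs_compat[OF assms(1), of 1 "n - 1"] correlation_matsD[OF assms(1)] assms(2)
  by (intro Psi_eq) auto

text \<open>\<open>realisation\<close> supplies a compatible matrix, which \<open>Psi_eq\<close>
  identifies with \<open>Psi n \<rho>\<close>; both claims are then read off from
  compatibility.\<close>

lemma Psi_correlation_mat:
  assumes \<rho>: "\<rho> \<in> rho_cube n" and n: "n \<ge> 1"
  shows "Psi n \<rho> \<in> correlation_mats n" and "connected_partial_corrs n (Psi n \<rho>) = \<rho>"
proof -
  define Y where "Y = realisation n \<rho>"
  have in_cube: "\<rho> (i, j) \<in> {-1<..<1}" if "1 \<le> i" "i < j" "j \<le> n" for i j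
    using \<rho> that by (auto simp: rho_cube_def index_pairs_def)
  have Y: "Y \<in> carrier_mat n n" and sym: "unit_symmetric n Y" and compat: "compat_on n \<rho> Y 1 (n - 1)"
    unfolding Y_def by (rule realisation_carrier unit_symmetric_realisation compat_realisation)+
  have cube: "cube_on \<rho> 1 (n - 1)"
    using in_cube n by (auto simp: cube_on_def)
  have Psi: "Psi n \<rho> = Y"
    by (rule Psi_eq[OF Y sym cube compat])
  have "pos_def_mat n Y"
    using pos_def_mat_iff_quad[OF Y] compat_imp_quad_pos[OF sym cube compat, of n] by simp
  with Y sym show "Psi n \<rho> \<in> correlation_mats n"
    by (simp add: Psi correlation_matsI)
  show "connected_partial_corrs n (Psi n \<rho>) = \<rho>"
  proof (rule extensionalityI[of _ "index_pairs n"])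
    show "connected_partial_corrs n (Psi n \<rho>) \<in> extensional (index_pairs n)"
      by (simp add: connected_partial_corrs_def)
    show "\<rho> \<in> extensional (index_pairs n)"
      using \<rho> by (auto simp: rho_cube_def PiE_def)
    fix x assume x: "x \<in> index_pairs n"
    then obtain k j where "x = (k, j)" "1 \<le> k" "k < j" "j \<le> n"
      by (auto simp: index_pairs_def)
    moreover then obtain m where "j = Suc (k + m)"
      using less_imp_Suc_add by blast
    ultimately have k: "x = (k, Suc (k + m))" "1 \<le> k" "Suc (k + m) \<le> n"
      by auto
    have "partial_corr Y k (Suc (k + m)) {k + 1..Suc (k + m) - 1} = \<rho> (k, Suc (k + m))"
      by (subst partial_corr_connected[OF Y sym k(2,3)])
        (use cube compat k in \<open>auto simp: cube_on_def compat_on_def\<close>)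
    then show "connected_partial_corrs n (Psi n \<rho>) x = \<rho> x"
      using x k by (simp add: Psi connected_partial_corrs_def)
  qed
qed

theorem theorem5p1:
  fixes n :: nat
  assumes "n \<ge> 2"
  shows "bij_betw (Psi n) (rho_cube n) (correlation_mats n)
    \<and> (\<forall>Y \<in> correlation_mats n. inv_into (rho_cube n) (Psi n) Y = connected_partial_corrs n Y)
    \<and> (\<forall>Y \<in> correlation_mats n. Y = Psi n (connected_partial_corrs n Y)
          \<and> (\<exists>!\<rho>. \<rho> \<in> rho_cube n \<and> Y = Psi n \<rho>))"
proof -
  have n: "n \<ge> 1" using assms by simp
  have bij: "bij_betw (Psi n) (rho_cube n) (correlation_mats n)"
    by (rule bij_betwI[where g = "connected_partial_corrs n"])
      (use n in \<open>auto simp: Psi_correlation_mat Psi_connected_partial_corrs connected_partial_corrs_cube\<close>)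
  moreover have "inv_into (rho_cube n) (Psi n) Y = connected_partial_corrs n Y"
    if "Y \<in> correlation_mats n" for Y
    using that n bij
    by (intro inv_into_f_eq) (auto simp: bij_betw_def Psi_connected_partial_corrs connected_partial_corrs_cube)
  moreover have "\<exists>!\<rho>. \<rho> \<in> rho_cube n \<and> Y = Psi n \<rho>" if "Y \<in> correlation_mats n" for Y
    using that n by (metis Psi_correlation_mat(2) Psi_connected_partial_corrs connected_partial_corrs_cube)
  ultimately show ?thesis
    using n by (simp add: Psi_connected_partial_corrs)
qed

end
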